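(* Let $\mathsf{R}$ be a principal ideal domain, let $\varphi_1:\mathbb{HA}_{\mathsf{R}}\to\mathbb{IH}_{\mathsf{R}}$ and $\varphi_2:\mathbb{HA}_{\mathsf{R}}^{op}\to\mathbb{IH}_{\mathsf{R}}$ be the PROP morphisms obtained by composing the coproduct injections into $\mathbb{HA}_{\mathsf{R}}+\mathbb{HA}_{\mathsf{R}}^{op}$ with the quotient map to $\mathbb{IH}_{\mathsf{R}}$, and let $c\in\mathbb{IH}_{\mathsf{R}}[n,m]$ be any arrow. Then: (i) there exist $c_1$ in $\mathbb{HA}_{\mathsf{R}}^{op}$ and $c_2$ in $\mathbb{HA}_{\mathsf{R}}$ such that $c=\varphi_2(c_1);\varphi_1(c_2)$; (ii) there exist $c_3$ in $\mathbb{HA}_{\mathsf{R}}$ and $c_4$ in $\mathbb{HA}_{\mathsf{R}}^{op}$ such that $c=\varphi_1(c_3);\varphi_2(c_4)$.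
   Context: A PROP is a strict symmetric monoidal category whose objects are the natural numbers and whose monoidal product $\oplus$ on objects is addition. Morphisms of PROPs are identity-on-objects strict symmetric monoidal functors. Composition is written in diagrammatic order $f;g$. The PROP presented by generators $\Sigma$ and equations $E$ has as arrows the terms built from $\Sigma$, $\mathrm{id}_1$ and the symmetry $\sigma:=\sigma_{1,1}$ using $;$ and $\oplus$, modulo the laws of symmetric monoidal categories and the smallest congruence containing $E$. The PROP $\mathbb{HA}_{\mathsf{R}}$ has generators $\Delta_\bullet:1\to2$, $\varepsilon_\bullet:1\to0$, $\mu_\circ:2\to1$, $\eta_\circ:0\to1$ and $s_k:1\to1$ for each $k\in\mathsf{R}$, and equations (for all $k,k_1,k_2\in\mathsf{R}$): (A1) $(\eta_\circ\oplus\mathrm{id}_1);\mu_\circ=\mathrm{id}_1$; (A2) $\sigma;\mu_\circ=\mu_\circ$; (A3) $(\mu_\circ\oplus\mathrm{id}_1);\mu_\circ=(\mathrm{id}_1\oplus\mu_\circ);\mu_\circ$; (A4) $\Delta_\bullet;(\varepsilon_\bullet\oplus\mathrm{id}_1)=\mathrm{id}_1$; (A5) $\Delta_\bullet;\sigma=\Delta_\bullet$; (A6) $\Delta_\bullet;(\Delta_\bullet\oplus\mathrm{id}_1)=\Delta_\bullet;(\mathrm{id}_1\oplus\Delta_\bullet)$; (A7) $\mu_\circ;\varepsilon_\bullet=\varepsilon_\bullet\oplus\varepsilon_\bullet$; (A8) $\mu_\circ;\Delta_\bullet=(\Delta_\bullet\oplus\Delta_\bullet);(\mathrm{id}_1\oplus\sigma\oplus\mathrm{id}_1);(\mu_\circ\oplus\mu_\circ)$;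 (A9) $\eta_\circ;\Delta_\bullet=\eta_\circ\oplus\eta_\circ$; (A10) $\eta_\circ;\varepsilon_\bullet=\mathrm{id}_0$; (A11) $s_1=\mathrm{id}_1$; (A12) $s_{k_1};s_{k_2}=s_{k_1k_2}$; (A13) $\mu_\circ;s_k=(s_k\oplus s_k);\mu_\circ$; (A14) $\eta_\circ;s_k=\eta_\circ$; (A15) $s_k;\Delta_\bullet=\Delta_\bullet;(s_k\oplus s_k)$; (A16) $s_k;\varepsilon_\bullet=\varepsilon_\bullet$; (A17) $s_0=\varepsilon_\bullet;\eta_\circ$; (A18) $\Delta_\bullet;(s_{k_1}\oplus s_{k_2});\mu_\circ=s_{k_1+k_2}$. The opposite PROP $\mathbb{HA}_{\mathsf{R}}^{op}$ is presented by generators $\mu_\bullet:2\to1$, $\eta_\bullet:0\to1$, $\Delta_\circ:1\to2$, $\varepsilon_\circ:1\to0$, $\bar s_k:1\to1$ ($k\in\mathsf{R}$), the opposites of $\Delta_\bullet,\varepsilon_\bullet,\mu_\circ,\eta_\circ,s_k$ respectively, and the reversed equations (A1)$^{op}$–(A18)$^{op}$. The coproduct $\mathbb{HA}_{\mathsf{R}}+\mathbb{HA}_{\mathsf{R}}^{op}$ is presented by the disjoint union of the generators and of the equations. $\mathbb{IH}_{\mathsf{R}}$ is the quotient of $\mathbb{HA}_{\mathsf{R}}+\mathbb{HA}_{\mathsf{R}}^{op}$ by the following equations, for all non-zero $l\in\mathsf{R}$: (I1) $s_l;\bar s_l=\mathrm{id}_1$; (I2) $\bar s_l;s_l=\mathrm{id}_1$;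 (I3) $(\Delta_\circ\oplus\mathrm{id}_1);(\mathrm{id}_1\oplus\mu_\circ)=\mu_\circ;\Delta_\circ=(\mathrm{id}_1\oplus\Delta_\circ);(\mu_\circ\oplus\mathrm{id}_1)$; (I4) $(\Delta_\bullet\oplus\mathrm{id}_1);(\mathrm{id}_1\oplus\mu_\bullet)=\mu_\bullet;\Delta_\bullet=(\mathrm{id}_1\oplus\Delta_\bullet);(\mu_\bullet\oplus\mathrm{id}_1)$; (I5) $\eta_\circ;\Delta_\circ=\eta_\bullet;\Delta_\bullet;(\mathrm{id}_1\oplus s_{-1})$; (I6) $\mu_\circ;\varepsilon_\circ=(\mathrm{id}_1\oplus s_{-1});\mu_\bullet;\varepsilon_\bullet$; (I7) $\Delta_\circ;\mu_\circ=\mathrm{id}_1$; (I8) $\Delta_\bullet;\mu_\bullet=\mathrm{id}_1$. *)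

theory Defs
  imports "HOL-Algebra.Ring_Divisibility"
begin

section \<open>PROPs presented by generators and equations\<close>

text \<open>
  Composition \<open>;;\<close> is in diagrammatic order and \<open>\<boxplus>\<close> is the monoidal product. \<open>Id0\<close> is the
  empty diagram, the identity on the unit object 0, and \<open>Swap\<close> is the symmetry on \<open>1 + 1\<close>.
\<close>

datatype 'g tm =
    Gen 'g
  | Id0
  | Id1
  | Swap
  | Seq "'g tm" "'g tm"  (infixl \<open>;;\<close> 60)
  | Par "'g tm" "'g tm"  (infixl \<open>\<boxplus>\<close> 66)

record 'g presentation =
  gens :: "'g set"
  arity :: "'g \<Rightarrow> nat"
  coarity :: "'g \<Rightarrow> nat"
  eqns :: "('g tm \<times> 'g tm) set"

inductive has_type :: "('g, 'z) presentation_scheme \<Rightarrow> 'g tm \<Rightarrow> nat \<Rightarrow> nat \<Rightarrow> bool"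
  for P :: "('g, 'z) presentation_scheme" where
  gen: "g \<in> gens P \<Longrightarrow> has_type P (Gen g) (arity P g) (coarity P g)"
| id0: "has_type P Id0 0 0"
| id1: "has_type P Id1 1 1"
| swap: "has_type P Swap 2 2"
| seq: "\<lbrakk>has_type P t n m; has_type P u m k\<rbrakk> \<Longrightarrow> has_type P (t ;; u) n k"
| par: "\<lbrakk>has_type P t n m; has_type P u p q\<rbrakk> \<Longrightarrow> has_type P (t \<boxplus> u) (n + p) (m + q)"

fun idn :: "nat \<Rightarrow> 'g tm" where
  "idn 0 = Id0"
| "idn (Suc n) = Id1 \<boxplus> idn n"

text \<open>
  The symmetries \<open>1 + m \<rightarrow> m + 1\<close> and \<open>n + m \<rightarrow> m + n\<close>, assembled from \<^term>\<open>Swap\<close> as the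
  hexagon axioms dictate.
\<close>

fun swap1 :: "nat \<Rightarrow> 'g tm" where
  "swap1 0 = Id1"
| "swap1 (Suc m) = (Swap \<boxplus> idn m) ;; (Id1 \<boxplus> swap1 m)"

fun swaps :: "nat \<Rightarrow> nat \<Rightarrow> 'g tm" where
  "swaps 0 m = idn m"
| "swaps (Suc n) m = (Id1 \<boxplus> swaps n m) ;; (swap1 m \<boxplus> idn n)"

text \<open>
  \<open>prop_eq P\<close> relates well-typed terms only: it is the least congruence on them that contains
  the laws of strict symmetric monoidal categories and the equations of \<open>P\<close>.
\<close>

inductive prop_eq :: "('g, 'z) presentation_scheme \<Rightarrow> 'g tm \<Rightarrow> 'g tm \<Rightarrow> bool"
  for P :: "('g, 'z) presentation_scheme" where
  eqn: "\<lbrakk>(t, u) \<in> eqns P; has_type P t n m; has_type P u n m\<rbrakk> \<Longrightarrow> prop_eq P t u"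
| refl: "has_type P t n m \<Longrightarrow> prop_eq P t t"
| sym: "prop_eq P t u \<Longrightarrow> prop_eq P u t"
| trans: "\<lbrakk>prop_eq P t u; prop_eq P u v\<rbrakk> \<Longrightarrow> prop_eq P t v"
| cong_seq: "\<lbrakk>prop_eq P t t'; prop_eq P u u'; has_type P t n m; has_type P u m k\<rbrakk>
    \<Longrightarrow> prop_eq P (t ;; u) (t' ;; u')"
| cong_par: "\<lbrakk>prop_eq P t t'; prop_eq P u u'\<rbrakk> \<Longrightarrow> prop_eq P (t \<boxplus> u) (t' \<boxplus> u')"
| seq_assoc: "\<lbrakk>has_type P t n m; has_type P u m k; has_type P v k l\<rbrakk>
    \<Longrightarrow> prop_eq P ((t ;; u) ;; v) (t ;; (u ;; v))"
| seq_id_left: "has_type P t n m \<Longrightarrow> prop_eq P (idn n ;; t) t"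
| seq_id_right: "has_type P t n m \<Longrightarrow> prop_eq P (t ;; idn m) t"
| par_assoc: "\<lbrakk>has_type P t n m; has_type P u p q; has_type P v k l\<rbrakk>
    \<Longrightarrow> prop_eq P ((t \<boxplus> u) \<boxplus> v) (t \<boxplus> (u \<boxplus> v))"
| par_unit_left: "has_type P t n m \<Longrightarrow> prop_eq P (Id0 \<boxplus> t) t"
| par_unit_right: "has_type P t n m \<Longrightarrow> prop_eq P (t \<boxplus> Id0) t"
| interchange: "\<lbrakk>has_type P t n m; has_type P u m k; has_type P v p q; has_type P w q l\<rbrakk>
    \<Longrightarrow> prop_eq P ((t ;; u) \<boxplus> (v ;; w)) ((t \<boxplus> v) ;; (u \<boxplus> w))"
| swap_swap: "prop_eq P (swaps n m ;; swaps m n) (idn (n + m))"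
| swap_hexagon: "prop_eq P (swaps (n + m) k) ((idn n \<boxplus> swaps m k) ;; (swaps n k \<boxplus> idn m))"
| swap_natural: "\<lbrakk>has_type P t n m; has_type P u p q\<rbrakk>
    \<Longrightarrow> prop_eq P ((t \<boxplus> u) ;; swaps m q) (swaps n p ;; (u \<boxplus> t))"

definition arrows :: "('g, 'z) presentation_scheme \<Rightarrow> nat \<Rightarrow> nat \<Rightarrow> 'g tm set set" where
  "arrows P n m = {t. has_type P t n m} // {(t, u). prop_eq P t u}"

definition arrow_of :: "('g, 'z) presentation_scheme \<Rightarrow> 'g tm \<Rightarrow> 'g tm set" where
  "arrow_of P t = {u. prop_eq P t u}"

definition arrow_comp :: "('g, 'z) presentation_scheme \<Rightarrow> 'g tm set \<Rightarrow> 'g tm set \<Rightarrow> 'g tm set" where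
  "arrow_comp P a b = (\<Union>t\<in>a. \<Union>u\<in>b. arrow_of P (t ;; u))"

definition arrow_tensor :: "('g, 'z) presentation_scheme \<Rightarrow> 'g tm set \<Rightarrow> 'g tm set \<Rightarrow> 'g tm set" where
  "arrow_tensor P a b = (\<Union>t\<in>a. \<Union>u\<in>b. arrow_of P (t \<boxplus> u))"

text \<open>The map on arrows, with values in the PROP presented by \<open>P\<close>, given by a translation of terms.\<close>

definition induced :: "('h, 'z) presentation_scheme \<Rightarrow> ('g tm \<Rightarrow> 'h tm) \<Rightarrow> 'g tm set \<Rightarrow> 'h tm set" where
  "induced P f a = (\<Union>t\<in>a. arrow_of P (f t))"


section \<open>Opposite, coproduct and quotient\<close>

fun rev_tm :: "'g tm \<Rightarrow> 'g tm" where
  "rev_tm (t ;; u) = rev_tm u ;; rev_tm t"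
| "rev_tm (t \<boxplus> u) = rev_tm t \<boxplus> rev_tm u"
| "rev_tm t = t"

text \<open>In \<open>op_pres P\<close> the name \<open>g\<close> stands for the opposite of the generator \<open>g\<close> of \<open>P\<close>.\<close>

definition op_pres :: "'g presentation \<Rightarrow> 'g presentation" where
  "op_pres P = \<lparr>gens = gens P, arity = coarity P, coarity = arity P,
     eqns = map_prod rev_tm rev_tm ` eqns P\<rparr>"

definition coprod_pres :: "'g presentation \<Rightarrow> 'h presentation \<Rightarrow> ('g + 'h) presentation" where
  "coprod_pres P Q =
     \<lparr>gens = Inl ` gens P \<union> Inr ` gens Q,
      arity = case_sum (arity P) (arity Q),
      coarity = case_sum (coarity P) (coarity Q),
      eqns = map_prod (map_tm Inl) (map_tm Inl) ` eqns P \<union> map_prod (map_tm Inr) (map_tm Inr) ` eqns Q\<rparr>"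

definition quot_pres :: "'g presentation \<Rightarrow> ('g tm \<times> 'g tm) set \<Rightarrow> 'g presentation" where
  "quot_pres P E = P\<lparr>eqns := eqns P \<union> E\<rparr>"


section \<open>The PROP of Hopf algebras\<close>

text \<open>The letters \<open>b\<close> and \<open>w\<close> stand for the black and the white structure.\<close>

datatype 'r ha_gen = Comult_b | Counit_b | Mult_w | Unit_w | Scal 'r

fun ha_arity :: "'r ha_gen \<Rightarrow> nat" where
  "ha_arity Comult_b = 1"
| "ha_arity Counit_b = 1"
| "ha_arity Mult_w = 2"
| "ha_arity Unit_w = 0"
| "ha_arity (Scal k) = 1"

fun ha_coarity :: "'r ha_gen \<Rightarrow> nat" where
  "ha_coarity Comult_b = 2"
| "ha_coarity Counit_b = 0"
| "ha_coarity Mult_w = 1"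
| "ha_coarity Unit_w = 1"
| "ha_coarity (Scal k) = 1"

inductive_set ha_eqns :: "('r, 'z) ring_scheme \<Rightarrow> ('r ha_gen tm \<times> 'r ha_gen tm) set"
  for R (structure) where
  mult_unit: "((Gen Unit_w \<boxplus> Id1) ;; Gen Mult_w, Id1) \<in> ha_eqns R"
| mult_comm: "(Swap ;; Gen Mult_w, Gen Mult_w) \<in> ha_eqns R"
| mult_assoc: "((Gen Mult_w \<boxplus> Id1) ;; Gen Mult_w, (Id1 \<boxplus> Gen Mult_w) ;; Gen Mult_w) \<in> ha_eqns R"
| comult_counit: "(Gen Comult_b ;; (Gen Counit_b \<boxplus> Id1), Id1) \<in> ha_eqns R"
| comult_comm: "(Gen Comult_b ;; Swap, Gen Comult_b) \<in> ha_eqns R"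
| comult_assoc: "(Gen Comult_b ;; (Gen Comult_b \<boxplus> Id1), Gen Comult_b ;; (Id1 \<boxplus> Gen Comult_b)) \<in> ha_eqns R"
| mult_counit: "(Gen Mult_w ;; Gen Counit_b, Gen Counit_b \<boxplus> Gen Counit_b) \<in> ha_eqns R"
| mult_comult: "(Gen Mult_w ;; Gen Comult_b,
    (Gen Comult_b \<boxplus> Gen Comult_b) ;; (Id1 \<boxplus> Swap \<boxplus> Id1) ;; (Gen Mult_w \<boxplus> Gen Mult_w)) \<in> ha_eqns R"
| unit_comult: "(Gen Unit_w ;; Gen Comult_b, Gen Unit_w \<boxplus> Gen Unit_w) \<in> ha_eqns R"
| unit_counit: "(Gen Unit_w ;; Gen Counit_b, Id0) \<in> ha_eqns R"
| scal_one: "(Gen (Scal \<one>), Id1) \<in> ha_eqns R"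
| scal_scal: "\<lbrakk>k1 \<in> carrier R; k2 \<in> carrier R\<rbrakk>
    \<Longrightarrow> (Gen (Scal k1) ;; Gen (Scal k2), Gen (Scal (k1 \<otimes> k2))) \<in> ha_eqns R"
| mult_scal: "k \<in> carrier R
    \<Longrightarrow> (Gen Mult_w ;; Gen (Scal k), (Gen (Scal k) \<boxplus> Gen (Scal k)) ;; Gen Mult_w) \<in> ha_eqns R"
| unit_scal: "k \<in> carrier R \<Longrightarrow> (Gen Unit_w ;; Gen (Scal k), Gen Unit_w) \<in> ha_eqns R"
| scal_comult: "k \<in> carrier R
    \<Longrightarrow> (Gen (Scal k) ;; Gen Comult_b, Gen Comult_b ;; (Gen (Scal k) \<boxplus> Gen (Scal k))) \<in> ha_eqns R"
| scal_counit: "k \<in> carrier R \<Longrightarrow> (Gen (Scal k) ;; Gen Counit_b, Gen Counit_b) \<in> ha_eqns R"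
| scal_zero: "(Gen (Scal \<zero>), Gen Counit_b ;; Gen Unit_w) \<in> ha_eqns R"
| scal_add: "\<lbrakk>k1 \<in> carrier R; k2 \<in> carrier R\<rbrakk>
    \<Longrightarrow> (Gen Comult_b ;; (Gen (Scal k1) \<boxplus> Gen (Scal k2)) ;; Gen Mult_w, Gen (Scal (k1 \<oplus> k2))) \<in> ha_eqns R"

definition HA :: "('r, 'z) ring_scheme \<Rightarrow> 'r ha_gen presentation" where
  "HA R = \<lparr>gens = {Comult_b, Counit_b, Mult_w, Unit_w} \<union> Scal ` carrier R,
     arity = ha_arity, coarity = ha_coarity, eqns = ha_eqns R\<rparr>"

definition HAop :: "('r, 'z) ring_scheme \<Rightarrow> 'r ha_gen presentation" where
  "HAop R = op_pres (HA R)"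

definition HA_HAop :: "('r, 'z) ring_scheme \<Rightarrow> ('r ha_gen + 'r ha_gen) presentation" where
  "HA_HAop R = coprod_pres (HA R) (HAop R)"


section \<open>The PROP of interacting Hopf algebras\<close>

abbreviation \<Delta>\<^sub>b :: "('r ha_gen + 'r ha_gen) tm" where "\<Delta>\<^sub>b \<equiv> Gen (Inl Comult_b)"
abbreviation \<epsilon>\<^sub>b :: "('r ha_gen + 'r ha_gen) tm" where "\<epsilon>\<^sub>b \<equiv> Gen (Inl Counit_b)"
abbreviation \<mu>\<^sub>w :: "('r ha_gen + 'r ha_gen) tm" where "\<mu>\<^sub>w \<equiv> Gen (Inl Mult_w)"
abbreviation \<eta>\<^sub>w :: "('r ha_gen + 'r ha_gen) tm" where "\<eta>\<^sub>w \<equiv> Gen (Inl Unit_w)"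
abbreviation scal :: "'r \<Rightarrow> ('r ha_gen + 'r ha_gen) tm" where "scal k \<equiv> Gen (Inl (Scal k))"

abbreviation \<mu>\<^sub>b :: "('r ha_gen + 'r ha_gen) tm" where "\<mu>\<^sub>b \<equiv> Gen (Inr Comult_b)"
abbreviation \<eta>\<^sub>b :: "('r ha_gen + 'r ha_gen) tm" where "\<eta>\<^sub>b \<equiv> Gen (Inr Counit_b)"
abbreviation \<Delta>\<^sub>w :: "('r ha_gen + 'r ha_gen) tm" where "\<Delta>\<^sub>w \<equiv> Gen (Inr Mult_w)"
abbreviation \<epsilon>\<^sub>w :: "('r ha_gen + 'r ha_gen) tm" where "\<epsilon>\<^sub>w \<equiv> Gen (Inr Unit_w)"
abbreviation scal_op :: "'r \<Rightarrow> ('r ha_gen + 'r ha_gen) tm" where "scal_op k \<equiv> Gen (Inr (Scal k))"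

inductive_set ih_eqns ::
    "('r, 'z) ring_scheme \<Rightarrow> (('r ha_gen + 'r ha_gen) tm \<times> ('r ha_gen + 'r ha_gen) tm) set"
  for R (structure) where
  scal_scal_op: "\<lbrakk>l \<in> carrier R; l \<noteq> \<zero>\<rbrakk> \<Longrightarrow> (scal l ;; scal_op l, Id1) \<in> ih_eqns R"
| scal_op_scal: "\<lbrakk>l \<in> carrier R; l \<noteq> \<zero>\<rbrakk> \<Longrightarrow> (scal_op l ;; scal l, Id1) \<in> ih_eqns R"
| frobenius_w1: "((\<Delta>\<^sub>w \<boxplus> Id1) ;; (Id1 \<boxplus> \<mu>\<^sub>w), \<mu>\<^sub>w ;; \<Delta>\<^sub>w) \<in> ih_eqns R"
| frobenius_w2: "(\<mu>\<^sub>w ;; \<Delta>\<^sub>w, (Id1 \<boxplus> \<Delta>\<^sub>w) ;; (\<mu>\<^sub>w \<boxplus> Id1)) \<in> ih_eqns R"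
| frobenius_b1: "((\<Delta>\<^sub>b \<boxplus> Id1) ;; (Id1 \<boxplus> \<mu>\<^sub>b), \<mu>\<^sub>b ;; \<Delta>\<^sub>b) \<in> ih_eqns R"
| frobenius_b2: "(\<mu>\<^sub>b ;; \<Delta>\<^sub>b, (Id1 \<boxplus> \<Delta>\<^sub>b) ;; (\<mu>\<^sub>b \<boxplus> Id1)) \<in> ih_eqns R"
| cup: "(\<eta>\<^sub>w ;; \<Delta>\<^sub>w, \<eta>\<^sub>b ;; \<Delta>\<^sub>b ;; (Id1 \<boxplus> scal (\<ominus> \<one>))) \<in> ih_eqns R"
| cap: "(\<mu>\<^sub>w ;; \<epsilon>\<^sub>w, (Id1 \<boxplus> scal (\<ominus> \<one>)) ;; \<mu>\<^sub>b ;; \<epsilon>\<^sub>b) \<in> ih_eqns R"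
| special_w: "(\<Delta>\<^sub>w ;; \<mu>\<^sub>w, Id1) \<in> ih_eqns R"
| special_b: "(\<Delta>\<^sub>b ;; \<mu>\<^sub>b, Id1) \<in> ih_eqns R"

definition IH :: "('r, 'z) ring_scheme \<Rightarrow> ('r ha_gen + 'r ha_gen) presentation" where
  "IH R = quot_pres (HA_HAop R) (ih_eqns R)"

definition inj1 :: "('r, 'z) ring_scheme \<Rightarrow> 'r ha_gen tm set \<Rightarrow> ('r ha_gen + 'r ha_gen) tm set" where
  "inj1 R = induced (HA_HAop R) (map_tm Inl)"

definition inj2 :: "('r, 'z) ring_scheme \<Rightarrow> 'r ha_gen tm set \<Rightarrow> ('r ha_gen + 'r ha_gen) tm set" where
  "inj2 R = induced (HA_HAop R) (map_tm Inr)"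

definition quot_map ::
    "('r, 'z) ring_scheme \<Rightarrow> ('r ha_gen + 'r ha_gen) tm set \<Rightarrow> ('r ha_gen + 'r ha_gen) tm set" where
  "quot_map R = induced (IH R) id"

definition \<phi>1 :: "('r, 'z) ring_scheme \<Rightarrow> 'r ha_gen tm set \<Rightarrow> ('r ha_gen + 'r ha_gen) tm set" where
  "\<phi>1 R = quot_map R \<circ> inj1 R"

definition \<phi>2 :: "('r, 'z) ring_scheme \<Rightarrow> 'r ha_gen tm set \<Rightarrow> ('r ha_gen + 'r ha_gen) tm set" where
  "\<phi>2 R = quot_map R \<circ> inj2 R"


section \<open>Well-definedness\<close>

inductive_cases has_type_GenE: "has_type P (Gen g) n m"
inductive_cases has_type_Id0E: "has_type P Id0 n m"
inductive_cases has_type_Id1E: "has_type P Id1 n m"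
inductive_cases has_type_SwapE: "has_type P Swap n m"
inductive_cases has_type_SeqE: "has_type P (t ;; u) n k"
inductive_cases has_type_ParE: "has_type P (t \<boxplus> u) n m"

lemma has_type_unique:
  "has_type P t n m \<Longrightarrow> has_type P t n' m' \<Longrightarrow> n' = n \<and> m' = m"
proof (induction arbitrary: n' m' rule: has_type.induct)
  case (gen g)
  then show ?case by (elim has_type_GenE) simp
next
  case id0
  then show ?case by (elim has_type_Id0E) simp
next
  case id1
  then show ?case by (elim has_type_Id1E) simp
next
  case swap
  then show ?case by (elim has_type_SwapE) simp
next
  case (seq t n m u k)
  from seq.prems show ?case by (rule has_type_SeqE) (use seq.IH in blast)
next
  case (par t n m u p q)
  from par.prems show ?case by (rule has_type_ParE) (use par.IH in blast)
qed

lemma has_type_idn: "has_type P (idn n) n n"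
proof (induction n)
  case (Suc n)
  then show ?case using has_type.par[OF has_type.id1] by fastforce
qed (auto intro: has_type.intros)

lemma has_type_swap1: "has_type P (swap1 m) (Suc m) (Suc m)"
proof (induction m)
  case (Suc m)
  have "has_type P (Swap \<boxplus> idn m) (2 + m) (2 + m)"
    by (intro has_type.intros has_type_idn)
  moreover have "has_type P (Id1 \<boxplus> swap1 m) (1 + Suc m) (1 + Suc m)"
    by (intro has_type.intros Suc)
  ultimately show ?case by (auto intro: has_type.seq)
qed (use has_type.id1 in fastforce)

lemma has_type_swaps: "has_type P (swaps n m) (n + m) (m + n)"
proof (induction n)
  case (Suc n)
  have "has_type P (Id1 \<boxplus> swaps n m) (1 + (n + m)) (1 + (m + n))"
    by (intro has_type.intros Suc)
  moreover have "has_type P (swap1 m \<boxplus> idn n) (Suc m + n) (Suc m + n)"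
    by (intro has_type.intros has_type_idn has_type_swap1)
  ultimately show ?case by (auto intro: has_type.seq)
qed (simp add: has_type_idn)

lemma prop_eq_has_type:
  "prop_eq P t u \<Longrightarrow> \<exists>n m. has_type P t n m \<and> has_type P u n m"
proof (induction rule: prop_eq.induct)
  case (eqn t u n m)
  then show ?case by blast
next
  case (refl t n m)
  then show ?case by blast
next
  case (sym t u)
  then show ?case by blast
next
  case (trans t u v)
  then show ?case using has_type_unique by blast
next
  case (cong_seq t t' u u' n m k)
  then have "has_type P t' n m" "has_type P u' m k"
    using has_type_unique by blast+
  then show ?case using cong_seq has_type.seq by blast
next
  case (cong_par t t' u u')
  then show ?case using has_type.par by blast
next
  case (seq_assoc t n m u k v l)
  then have "has_type P (t ;; u ;; v) n l" "has_type P (t ;; (u ;; v)) n l"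
    using has_type.seq by blast+
  then show ?case by blast
next
  case (seq_id_left t n m)
  then show ?case using has_type.seq[OF has_type_idn] by blast
next
  case (seq_id_right t n m)
  then show ?case using has_type.seq[OF _ has_type_idn] by blast
next
  case (par_assoc t n m u p q v k l)
  then have "has_type P (t \<boxplus> u \<boxplus> v) (n + p + k) (m + q + l)"
    "has_type P (t \<boxplus> (u \<boxplus> v)) (n + (p + k)) (m + (q + l))"
    by (simp_all only: has_type.par)
  then show ?case unfolding add.assoc by blast
next
  case (par_unit_left t n m)
  then show ?case using has_type.par[OF has_type.id0] by fastforce
next
  case (par_unit_right t n m)
  then show ?case using has_type.par[OF _ has_type.id0] by fastforce
next
  case (interchange t n m u k v p q w l)
  have "has_type P ((t ;; u) \<boxplus> (v ;; w)) (n + p) (k + l)"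
    by (rule has_type.par; rule has_type.seq) (rule interchange)+
  moreover have "has_type P ((t \<boxplus> v) ;; (u \<boxplus> w)) (n + p) (k + l)"
    by (rule has_type.seq; rule has_type.par) (rule interchange)+
  ultimately show ?case by blast
next
  case (swap_swap n m)
  have "has_type P (swaps n m ;; swaps m n) (n + m) (n + m)"
    by (rule has_type.seq; rule has_type_swaps)
  then show ?case using has_type_idn by blast
next
  case (swap_hexagon n m k)
  have "has_type P (idn n \<boxplus> swaps m k) (n + (m + k)) (n + (k + m))"
    by (intro has_type.par has_type_idn has_type_swaps)
  moreover have "has_type P (swaps n k \<boxplus> idn m) (n + k + m) (k + n + m)"
    by (intro has_type.par has_type_idn has_type_swaps)
  ultimately have "has_type P ((idn n \<boxplus> swaps m k) ;; (swaps n k \<boxplus> idn m)) (n + m + k) (k + (n + m))"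
    unfolding add.assoc by (rule has_type.seq)
  then show ?case using has_type_swaps by blast
next
  case (swap_natural t n m u p q)
  have "has_type P ((t \<boxplus> u) ;; swaps m q) (n + p) (q + m)"
    by (rule has_type.seq, rule has_type.par, rule swap_natural, rule swap_natural, rule has_type_swaps)
  moreover have "has_type P (swaps n p ;; (u \<boxplus> t)) (n + p) (q + m)"
    by (rule has_type.seq, rule has_type_swaps, rule has_type.par) (rule swap_natural)+
  ultimately show ?case by blast
qed

lemma equiv_prop_eq: "equiv {t. \<exists>n m. has_type P t n m} {(t, u). prop_eq P t u}"
proof (rule equivI)
  show "{(t, u). prop_eq P t u} \<subseteq> {t. \<exists>n m. has_type P t n m} \<times> {t. \<exists>n m. has_type P t n m}"
    using prop_eq_has_type by blast
  show "refl_on {t. \<exists>n m. has_type P t n m} {(t, u). prop_eq P t u}"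
    using prop_eq.refl by (force intro: refl_onI)
  show "sym {(t, u). prop_eq P t u}"
    using prop_eq.sym by (force intro: symI)
  show "trans {(t, u). prop_eq P t u}"
    using prop_eq.trans by (force intro: transI)
qed

lemma arrow_of_eq_iff:
  assumes "has_type P t n m"
  shows "arrow_of P t = arrow_of P u \<longleftrightarrow> prop_eq P t u"
  using assms unfolding arrow_of_def
  by (auto intro: prop_eq.refl prop_eq.sym prop_eq.trans)

lemma arrows_eq: "arrows P n m = arrow_of P ` {t. has_type P t n m}"
  by (auto simp: arrows_def quotient_def arrow_of_def)

lemma arrow_comp_arrow_of:
  assumes t: "has_type P t n m" and u: "has_type P u m k"
  shows "arrow_comp P (arrow_of P t) (arrow_of P u) = arrow_of P (t ;; u)"
proof -
  have "prop_eq P (t ;; u) (t' ;; u')" if "prop_eq P t t'" "prop_eq P u u'" for t' u'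
    using that t u by (rule prop_eq.cong_seq)
  moreover have "prop_eq P t t" "prop_eq P u u"
    using t u by (auto intro: prop_eq.refl)
  ultimately show ?thesis
    unfolding arrow_comp_def arrow_of_def by (auto intro: prop_eq.trans)
qed

lemma arrow_tensor_arrow_of:
  assumes t: "has_type P t n m" and u: "has_type P u p q"
  shows "arrow_tensor P (arrow_of P t) (arrow_of P u) = arrow_of P (t \<boxplus> u)"
proof -
  have "prop_eq P (t \<boxplus> u) (t' \<boxplus> u')" if "prop_eq P t t'" "prop_eq P u u'" for t' u'
    using that by (rule prop_eq.cong_par)
  moreover have "prop_eq P t t" "prop_eq P u u"
    using t u by (auto intro: prop_eq.refl)
  ultimately show ?thesis
    unfolding arrow_tensor_def arrow_of_def by (auto intro: prop_eq.trans)
qed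

lemma map_tm_idn: "map_tm f (idn n) = idn n"
  by (induction n) auto

lemma map_tm_swap1: "map_tm f (swap1 n) = swap1 n"
  by (induction n) (auto simp: map_tm_idn)

lemma map_tm_swaps: "map_tm f (swaps n m) = swaps n m"
  by (induction n) (auto simp: map_tm_idn map_tm_swap1)

context
  fixes P :: "('g, 'y) presentation_scheme" and Q :: "('h, 'z) presentation_scheme"
    and f :: "'g \<Rightarrow> 'h"
  assumes gens: "\<And>g. g \<in> gens P \<Longrightarrow>
      f g \<in> gens Q \<and> arity Q (f g) = arity P g \<and> coarity Q (f g) = coarity P g"
    and eqns: "\<And>t u. (t, u) \<in> eqns P \<Longrightarrow> (map_tm f t, map_tm f u) \<in> eqns Q"
begin

lemma has_type_map_tm: "has_type P t n m \<Longrightarrow> has_type Q (map_tm f t) n m"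
proof (induction rule: has_type.induct)
  case (gen g)
  then show ?case using has_type.gen[of "f g" Q] gens by simp
qed (simp only: tm.map, rule has_type.intros; assumption)+

lemma prop_eq_map_tm: "prop_eq P t u \<Longrightarrow> prop_eq Q (map_tm f t) (map_tm f u)"
proof (induction rule: prop_eq.induct)
  case (trans t u v)
  then show ?case using prop_eq.trans by blast
next
  case (sym t u)
  then show ?case using prop_eq.sym by blast
next
  case (eqn t u n m)
  then show ?case
    unfolding tm.map map_tm_idn map_tm_swaps using prop_eq.eqn has_type_map_tm eqns by blast
next
  case (refl t n m)
  then show ?case
    unfolding tm.map map_tm_idn map_tm_swaps using prop_eq.refl has_type_map_tm by blast
next
  case (cong_seq t t' u u' n m k)
  then show ?case
    unfolding tm.map map_tm_idn map_tm_swaps using prop_eq.cong_seq has_type_map_tm by blast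
next
  case (cong_par t t' u u')
  then show ?case
    unfolding tm.map map_tm_idn map_tm_swaps using prop_eq.cong_par has_type_map_tm by blast
next
  case (seq_assoc t n m u k v l)
  then show ?case
    unfolding tm.map map_tm_idn map_tm_swaps using prop_eq.seq_assoc has_type_map_tm by blast
next
  case (seq_id_left t n m)
  then show ?case
    unfolding tm.map map_tm_idn map_tm_swaps using prop_eq.seq_id_left has_type_map_tm by blast
next
  case (seq_id_right t n m)
  then show ?case
    unfolding tm.map map_tm_idn map_tm_swaps using prop_eq.seq_id_right has_type_map_tm by blast
next
  case (par_assoc t n m u p q v k l)
  then show ?case
    unfolding tm.map map_tm_idn map_tm_swaps using prop_eq.par_assoc has_type_map_tm by blast
next
  case (par_unit_left t n m)
  then show ?case
    unfolding tm.map map_tm_idn map_tm_swaps using prop_eq.par_unit_left has_type_map_tm by blast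
next
  case (par_unit_right t n m)
  then show ?case
    unfolding tm.map map_tm_idn map_tm_swaps using prop_eq.par_unit_right has_type_map_tm by blast
next
  case (interchange t n m u k v p q w l)
  then show ?case
    unfolding tm.map map_tm_idn map_tm_swaps using prop_eq.interchange has_type_map_tm by blast
next
  case (swap_swap n m)
  then show ?case
    unfolding tm.map map_tm_idn map_tm_swaps using prop_eq.swap_swap has_type_map_tm by blast
next
  case (swap_hexagon n m k)
  then show ?case
    unfolding tm.map map_tm_idn map_tm_swaps using prop_eq.swap_hexagon has_type_map_tm by blast
next
  case (swap_natural t n m u p q)
  then show ?case
    unfolding tm.map map_tm_idn map_tm_swaps using prop_eq.swap_natural has_type_map_tm by blast
qed

lemma induced_arrow_of:
  assumes "has_type P t n m"
  shows "induced Q (map_tm f) (arrow_of P t) = arrow_of Q (map_tm f t)"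
  using prop_eq.refl[OF assms] prop_eq_map_tm
  unfolding induced_def arrow_of_def by (auto intro: prop_eq.trans)

end

lemma gens_HA_HAop:
  "g \<in> gens (HA R) \<Longrightarrow> Inl g \<in> gens (HA_HAop R) \<and> arity (HA_HAop R) (Inl g) = arity (HA R) g
     \<and> coarity (HA_HAop R) (Inl g) = coarity (HA R) g"
  "g \<in> gens (HAop R) \<Longrightarrow> Inr g \<in> gens (HA_HAop R) \<and> arity (HA_HAop R) (Inr g) = arity (HAop R) g
     \<and> coarity (HA_HAop R) (Inr g) = coarity (HAop R) g"
  by (auto simp: HA_HAop_def coprod_pres_def)

lemma eqns_HA_HAop:
  "(t, u) \<in> eqns (HA R) \<Longrightarrow> (map_tm Inl t, map_tm Inl u) \<in> eqns (HA_HAop R)"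
  "(t, u) \<in> eqns (HAop R) \<Longrightarrow> (map_tm Inr t, map_tm Inr u) \<in> eqns (HA_HAop R)"
  by (auto simp: HA_HAop_def coprod_pres_def intro: rev_image_eqI)

lemma quot_map_arrow_of:
  assumes "has_type (HA_HAop R) t n m"
  shows "quot_map R (arrow_of (HA_HAop R) t) = arrow_of (IH R) t"
  using induced_arrow_of[where P="HA_HAop R" and Q="IH R" and f=id, OF _ _ assms]
  by (simp add: quot_map_def IH_def quot_pres_def tm.map_id0)

lemma \<phi>1_arrow_of:
  assumes "has_type (HA R) t n m"
  shows "\<phi>1 R (arrow_of (HA R) t) = arrow_of (IH R) (map_tm Inl t)"
  using induced_arrow_of[where P="HA R" and Q="HA_HAop R" and f=Inl, OF gens_HA_HAop(1) eqns_HA_HAop(1) assms]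
    quot_map_arrow_of[OF has_type_map_tm[where P="HA R" and Q="HA_HAop R" and f=Inl, OF gens_HA_HAop(1) eqns_HA_HAop(1) assms]]
  by (simp add: \<phi>1_def inj1_def)

lemma \<phi>2_arrow_of:
  assumes "has_type (HAop R) t n m"
  shows "\<phi>2 R (arrow_of (HAop R) t) = arrow_of (IH R) (map_tm Inr t)"
  using induced_arrow_of[where P="HAop R" and Q="HA_HAop R" and f=Inr, OF gens_HA_HAop(2) eqns_HA_HAop(2) assms]
    quot_map_arrow_of[OF has_type_map_tm[where P="HAop R" and Q="HA_HAop R" and f=Inr, OF gens_HA_HAop(2) eqns_HA_HAop(2) assms]]
  by (simp add: \<phi>2_def inj2_def)

text \<open>All the equations are between well-typed terms, so none of them is lost in \<^const>\<open>prop_eq\<close>.\<close>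

lemma has_type_rev_tm: "has_type P t n m \<Longrightarrow> has_type (op_pres P) (rev_tm t) m n"
proof (induction rule: has_type.induct)
  case (gen g)
  then show ?case using has_type.gen[of g "op_pres P"] by (simp add: op_pres_def)
qed (simp only: rev_tm.simps, rule has_type.intros; assumption)+

lemma has_type_gen':
  "\<lbrakk>g \<in> gens P; arity P g = n; coarity P g = m\<rbrakk> \<Longrightarrow> has_type P (Gen g) n m"
  using has_type.gen by metis

lemma has_type_par':
  "\<lbrakk>has_type P t n m; has_type P u p q; n + p = N; m + q = M\<rbrakk> \<Longrightarrow> has_type P (t \<boxplus> u) N M"
  using has_type.par by metis

lemmas has_type_rules =
  has_type_gen' has_type_par' has_type.id0 has_type.id1 has_type.swap has_type.seq

lemma has_type_ha_eqns:
  assumes "ring R" and "(t, u) \<in> ha_eqns R"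
  shows "\<exists>n m. has_type (HA R) t n m \<and> has_type (HA R) u n m"
  using assms(2)
proof (induction rule: ha_eqns.induct)
qed ((rule exI)+, rule conjI;
      ((rule has_type_rules | (simp add: HA_def assms(1) ring.ring_simprules; fail))+; fail))+

lemma has_type_ih_eqns:
  assumes "ring R" and "(t, u) \<in> ih_eqns R"
  shows "\<exists>n m. has_type (IH R) t n m \<and> has_type (IH R) u n m"
  using assms(2)
proof (induction rule: ih_eqns.induct)
qed ((rule exI)+, rule conjI;
      ((rule has_type_rules | (simp add: HA_def HAop_def op_pres_def HA_HAop_def coprod_pres_def
          IH_def quot_pres_def image_iff assms(1) ring.ring_simprules; fail))+; fail))+

end

theory Submission
  imports Defs
begin

text \<open>
  Fix the domain of arrows. A diagram is then a sequence of generators, each attached at some wire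
  position to the outputs of what has been built so far, and both claims are about reordering such
  sequences. Let \<open>G\<close> be the class of arrows that are built with opposite generators first and then
  with generators of the Hopf algebra PROP. It is closed under attaching the latter, and every
  opposite generator can be expressed by these together with \<open>\<epsilon>\<^sub>w\<close> and \<open>\<eta>\<^sub>b\<close>. Since \<open>\<eta>\<^sub>b\<close> slides to
  the front, only \<open>\<epsilon>\<^sub>w\<close> after an arrow of the Hopf algebra PROP matters. Such an arrow is a matrix,
  and \<open>\<epsilon>\<^sub>w\<close> imposes the linear equation given by one of its rows. If the coefficient of the current
  variable is zero, the variable is skipped. Once a nonzero coefficient \<open>r\<close> is met, every later
  variable is multiplied by \<open>r\<close> and sheared into the current one. Shears are arrows of both PROPs,
  and the rescaling is undone in front by \<open>scal_op r\<close>, so both are absorbed by the opposite part.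
  No gcd is needed, because nonzero scalars are invertible in \<open>IH\<close>. This gives (i). Exchanging the
  two colours exchanges both sub-PROPs without reversing diagrams, which turns (i) into (ii).
\<close>

section \<open>Hopf algebras acting on wires\<close>

text \<open>Arities are read off the syntax, so that wire positions can be stated for all terms
  without typing hypotheses; on well-typed terms they are the true ones
  (\<open>has_type_IH_ar\<close>). The right copy consists of opposites, hence the exchanged roles
  in the generator case.\<close>

fun ar :: "('r ha_gen + 'r ha_gen) tm \<Rightarrow> nat" where
  "ar (Gen g) = case_sum ha_arity ha_coarity g"
| "ar Id0 = 0"
| "ar Id1 = Suc 0"
| "ar Swap = Suc (Suc 0)"
| "ar (t ;; u) = ar t"
| "ar (t \<boxplus> u) = ar t + ar u"

fun coar :: "('r ha_gen + 'r ha_gen) tm \<Rightarrow> nat" where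
  "coar (Gen g) = case_sum ha_coarity ha_arity g"
| "coar Id0 = 0"
| "coar Id1 = Suc 0"
| "coar Swap = Suc (Suc 0)"
| "coar (t ;; u) = coar u"
| "coar (t \<boxplus> u) = coar t + coar u"

lemma ar_gen [simp]:
  "ar \<Delta>\<^sub>b = Suc 0" "ar \<epsilon>\<^sub>b = Suc 0" "ar \<mu>\<^sub>w = Suc (Suc 0)" "ar \<eta>\<^sub>w = 0" "ar (scal k) = Suc 0"
  "ar \<Delta>\<^sub>w = Suc 0" "ar \<epsilon>\<^sub>w = Suc 0" "ar \<mu>\<^sub>b = Suc (Suc 0)" "ar \<eta>\<^sub>b = 0" "ar (scal_op k) = Suc 0"
  "coar \<Delta>\<^sub>b = Suc (Suc 0)" "coar \<epsilon>\<^sub>b = 0" "coar \<mu>\<^sub>w = Suc 0" "coar \<eta>\<^sub>w = Suc 0" "coar (scal k) = Suc 0"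
  "coar \<Delta>\<^sub>w = Suc (Suc 0)" "coar \<epsilon>\<^sub>w = 0" "coar \<mu>\<^sub>b = Suc 0" "coar \<eta>\<^sub>b = Suc 0" "coar (scal_op k) = Suc 0"
  by simp_all

declare ar.simps(1) [simp del] coar.simps(1) [simp del]

lemma has_type_IH_gen:
  fixes R :: "('r, 'z) ring_scheme" (structure)
  shows
  "has_type (IH R) \<Delta>\<^sub>b 1 2" "has_type (IH R) \<epsilon>\<^sub>b 1 0" "has_type (IH R) \<mu>\<^sub>w 2 1" "has_type (IH R) \<eta>\<^sub>w 0 1"
  "k \<in> carrier R \<Longrightarrow> has_type (IH R) (scal k) 1 1"
  "has_type (IH R) \<Delta>\<^sub>w 1 2" "has_type (IH R) \<epsilon>\<^sub>w 1 0" "has_type (IH R) \<mu>\<^sub>b 2 1" "has_type (IH R) \<eta>\<^sub>b 0 1"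
  "k \<in> carrier R \<Longrightarrow> has_type (IH R) (scal_op k) 1 1"
  by (rule has_type_gen'; force simp add: HA_def HAop_def op_pres_def HA_HAop_def coprod_pres_def
          IH_def quot_pres_def image_iff)+

text \<open>
  \<open>X i x\<close> attaches the generator \<open>X\<close> to the state \<open>x\<close>, its first input being wire \<open>i\<close>. The number
  of wires of \<open>x\<close> is \<open>w x - 1\<close>: the value \<open>w x = 0\<close> is reserved for an error state, which
  absorbs ill-typed attachments. This is what makes most laws unconditional.
\<close>

locale hopf =
  fixes R :: "('r, 'z) ring_scheme" (structure)
    and w :: "'x \<Rightarrow> nat"
    and D E M U :: "nat \<Rightarrow> 'x \<Rightarrow> 'x" and S :: "'r \<Rightarrow> nat \<Rightarrow> 'x \<Rightarrow> 'x" and T :: "nat \<Rightarrow> 'x \<Rightarrow> 'x"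
  assumes mult_unit: "Suc i < w x \<Longrightarrow> M i (U i x) = x"
    and mult_comm: "M i (T i x) = M i x"
    and mult_assoc: "M i (M i x) = M i (M (Suc i) x)"
    and comult_counit: "Suc i < w x \<Longrightarrow> E i (D i x) = x"
    and comult_comm: "T i (D i x) = D i x"
    and comult_assoc: "D i (D i x) = D (Suc i) (D i x)"
    and mult_counit: "E i (M i x) = E i (E (Suc i) x)"
    and mult_comult: "D i (M i x) = M i (M (Suc (Suc i)) (T (Suc i) (D i (D (Suc i) x))))"
    and unit_comult: "D i (U i x) = U i (U i x)"
    and unit_counit: "i < w x \<Longrightarrow> E i (U i x) = x"
    and scal_one: "Suc i < w x \<Longrightarrow> S \<one> i x = x"
    and scal_scal: "\<lbrakk>k1 \<in> carrier R; k2 \<in> carrier R\<rbrakk> \<Longrightarrow> S k2 i (S k1 i x) = S (k1 \<otimes> k2) i x"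
    and mult_scal: "k \<in> carrier R \<Longrightarrow> S k i (M i x) = M i (S k i (S k (Suc i) x))"
    and unit_scal: "k \<in> carrier R \<Longrightarrow> S k i (U i x) = U i x"
    and scal_comult: "k \<in> carrier R \<Longrightarrow> D i (S k i x) = S k i (S k (Suc i) (D i x))"
    and scal_counit: "k \<in> carrier R \<Longrightarrow> E i (S k i x) = E i x"
    and scal_zero: "S \<zero> i x = U i (E i x)"
    and scal_add: "\<lbrakk>k1 \<in> carrier R; k2 \<in> carrier R\<rbrakk>
      \<Longrightarrow> M i (S k1 i (S k2 (Suc i) (D i x))) = S (k1 \<oplus> k2) i x"
    and swap_comult: "T (Suc i) (T i (D (Suc i) x)) = D i (T i x)"
    and swap_counit: "E i (T i x) = E (Suc i) x"
    and swap_mult: "T i (M (Suc i) x) = M i (T (Suc i) (T i x))"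
    and swap_unit: "Suc i < w x \<Longrightarrow> T i (U (Suc i) x) = U i x"
    and swap_scal: "T i (S k (Suc i) x) = S k i (T i x)"

text \<open>These laws do not concern particular generators. \<open>comm\<close> is interchange for
  independent attachments: moving \<open>t\<close> in front of \<open>s\<close> renumbers its
  position, because \<open>s\<close> replaces \<open>ar s\<close> wires to the left of
  \<open>t\<close> by \<open>coar s\<close> wires.\<close>

locale wires =
  fixes R :: "('r, 'z) ring_scheme" (structure)
    and w :: "'x \<Rightarrow> nat" and ap :: "('r ha_gen + 'r ha_gen) tm \<Rightarrow> nat \<Rightarrow> 'x \<Rightarrow> 'x"
  assumes width: "\<lbrakk>has_type (IH R) t n m; i + n < w x\<rbrakk> \<Longrightarrow> w (ap t i x) = w x - n + m"
    and comm: "i + coar s \<le> j \<Longrightarrow> ap t j (ap s i x) = ap s i (ap t (j - coar s + ar s) x)"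
    and swap_swap: "Suc (Suc i) < w x \<Longrightarrow> ap Swap i (ap Swap i x) = x"
    and yang_baxter: "ap Swap (Suc i) (ap Swap i (ap Swap (Suc i) x))
      = ap Swap i (ap Swap (Suc i) (ap Swap i x))"

text \<open>The Hopf laws are self-dual: reversing them and exchanging the roles of multiplication
  and comultiplication gives the same list. So the opposite PROP is a second instance of
  \<open>hopf\<close>, with the white comultiplication and the black multiplication.\<close>

locale ih_wires = domain R + wires R w ap +
  H: hopf R w "ap \<Delta>\<^sub>b" "ap \<epsilon>\<^sub>b" "ap \<mu>\<^sub>w" "ap \<eta>\<^sub>w" "\<lambda>k. ap (scal k)" "ap Swap" +
  G: hopf R w "ap \<Delta>\<^sub>w" "ap \<epsilon>\<^sub>w" "ap \<mu>\<^sub>b" "ap \<eta>\<^sub>b" "\<lambda>k. ap (scal_op k)" "ap Swap"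
  for R :: "('r, 'z) ring_scheme" (structure)
    and w :: "'x \<Rightarrow> nat" and ap :: "('r ha_gen + 'r ha_gen) tm \<Rightarrow> nat \<Rightarrow> 'x \<Rightarrow> 'x" +
  assumes scal_scal_op: "\<lbrakk>l \<in> carrier R; l \<noteq> \<zero>; Suc i < w x\<rbrakk> \<Longrightarrow> ap (scal_op l) i (ap (scal l) i x) = x"
    and scal_op_scal: "\<lbrakk>l \<in> carrier R; l \<noteq> \<zero>; Suc i < w x\<rbrakk> \<Longrightarrow> ap (scal l) i (ap (scal_op l) i x) = x"
    and frobenius_w1: "ap \<mu>\<^sub>w (Suc i) (ap \<Delta>\<^sub>w i x) = ap \<Delta>\<^sub>w i (ap \<mu>\<^sub>w i x)"
    and frobenius_w2: "ap \<mu>\<^sub>w i (ap \<Delta>\<^sub>w (Suc i) x) = ap \<Delta>\<^sub>w i (ap \<mu>\<^sub>w i x)"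
    and frobenius_b1: "ap \<mu>\<^sub>b (Suc i) (ap \<Delta>\<^sub>b i x) = ap \<Delta>\<^sub>b i (ap \<mu>\<^sub>b i x)"
    and frobenius_b2: "ap \<mu>\<^sub>b i (ap \<Delta>\<^sub>b (Suc i) x) = ap \<Delta>\<^sub>b i (ap \<mu>\<^sub>b i x)"
    and cup: "i < w x \<Longrightarrow> ap \<Delta>\<^sub>w i (ap \<eta>\<^sub>w i x) = ap (scal (\<ominus> \<one>)) (Suc i) (ap \<Delta>\<^sub>b i (ap \<eta>\<^sub>b i x))"
    and cap: "Suc (Suc i) < w x \<Longrightarrow> ap \<epsilon>\<^sub>w i (ap \<mu>\<^sub>w i x) = ap \<epsilon>\<^sub>b i (ap \<mu>\<^sub>b i (ap (scal (\<ominus> \<one>)) (Suc i) x))"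
    and special_w: "Suc i < w x \<Longrightarrow> ap \<mu>\<^sub>w i (ap \<Delta>\<^sub>w i x) = x"
    and special_b: "Suc i < w x \<Longrightarrow> ap \<mu>\<^sub>b i (ap \<Delta>\<^sub>b i x) = x"
begin

abbreviation "D \<equiv> ap \<Delta>\<^sub>b"
abbreviation "E \<equiv> ap \<epsilon>\<^sub>b"
abbreviation "M \<equiv> ap \<mu>\<^sub>w"
abbreviation "U \<equiv> ap \<eta>\<^sub>w"
abbreviation "S k \<equiv> ap (scal k)"
abbreviation "D' \<equiv> ap \<Delta>\<^sub>w"
abbreviation "E' \<equiv> ap \<epsilon>\<^sub>w"
abbreviation "M' \<equiv> ap \<mu>\<^sub>b"
abbreviation "U' \<equiv> ap \<eta>\<^sub>b"
abbreviation "S' k \<equiv> ap (scal_op k)"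
abbreviation "T \<equiv> ap Swap"

lemma w_simps [simp]:
  "Suc i < w x \<Longrightarrow> w (D i x) = Suc (w x)"
  "Suc i < w x \<Longrightarrow> w (E i x) = w x - Suc 0"
  "Suc (Suc i) < w x \<Longrightarrow> w (M i x) = w x - Suc 0"
  "i < w x \<Longrightarrow> w (U i x) = Suc (w x)"
  "k \<in> carrier R \<Longrightarrow> Suc i < w x \<Longrightarrow> w (S k i x) = w x"
  "Suc i < w x \<Longrightarrow> w (D' i x) = Suc (w x)"
  "Suc i < w x \<Longrightarrow> w (E' i x) = w x - Suc 0"
  "Suc (Suc i) < w x \<Longrightarrow> w (M' i x) = w x - Suc 0"
  "i < w x \<Longrightarrow> w (U' i x) = Suc (w x)"
  "k \<in> carrier R \<Longrightarrow> Suc i < w x \<Longrightarrow> w (S' k i x) = w x"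
  "Suc (Suc i) < w x \<Longrightarrow> w (T i x) = w x"
  using width[OF has_type_IH_gen(1), of i x] width[OF has_type_IH_gen(2), of i x]
    width[OF has_type_IH_gen(3), of i x] width[OF has_type_IH_gen(4), of i x]
    width[OF has_type_IH_gen(5), of k i x] width[OF has_type_IH_gen(6), of i x]
    width[OF has_type_IH_gen(7), of i x] width[OF has_type_IH_gen(8), of i x]
    width[OF has_type_IH_gen(9), of i x] width[OF has_type_IH_gen(10), of k i x]
    width[OF has_type.swap, of i x]
  by auto

text \<open>The naturality laws of \<open>hopf\<close> pass a swap from one side only. Conjugation
  with the involutive swap gives the other side, here and in the next four lemmas.\<close>

lemma T_D: "Suc (Suc i) < w x \<Longrightarrow> D (Suc i) (T i x) = T i (T (Suc i) (D i x))"
  using H.swap_comult[of i "T i x", symmetric] by (simp add: swap_swap)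

lemma T_E: "Suc (Suc i) < w x \<Longrightarrow> E (Suc i) (T i x) = E i x"
  using H.swap_counit[of i "T i x", symmetric] by (simp add: swap_swap)

lemma T_S: "k \<in> carrier R \<Longrightarrow> Suc (Suc i) < w x \<Longrightarrow> S k (Suc i) (T i x) = T i (S k i x)"
  using H.swap_scal[of i k "T i x"] swap_swap[of i "S k (Suc i) (T i x)"] by (simp add: swap_swap)

lemma T_M: "Suc (Suc (Suc i)) < w x \<Longrightarrow> T i (M i x) = M (Suc i) (T i (T (Suc i) x))"
  using H.swap_mult[of i "T i (T (Suc i) x)", symmetric] by (simp add: swap_swap)

lemma T_U: "Suc i < w x \<Longrightarrow> T i (U i x) = U (Suc i) x"
  using H.swap_unit[of i x, symmetric] by (simp add: swap_swap)

lemma mult_unit': "Suc i < w x \<Longrightarrow> M i (U (Suc i) x) = x"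
  using H.mult_unit[of i x] H.mult_comm[of i "U (Suc i) x"] by (simp add: H.swap_unit)

lemma comult_counit': "Suc i < w x \<Longrightarrow> E (Suc i) (D i x) = x"
  using H.comult_counit[of i x] T_E[of i "D i x"] by (simp add: H.comult_comm)

lemma scal_S: "k \<in> carrier R \<Longrightarrow> S k i (T i x) = T i (S k (Suc i) x)"
  by (simp add: H.swap_scal)

text \<open>\<open>(t, y) \<mapsto> (t, y + r t)\<close> on the wires \<open>i\<close> and \<open>i + 1\<close>.\<close>

definition "shear r i x = M (Suc i) (S r (Suc i) (D i x))"

lemmas normalise = T_D T_E T_S T_M T_U mult_unit' comult_counit' H.mult_unit H.comult_counit
   H.mult_comm H.comult_comm H.swap_comult[symmetric] H.swap_counit H.swap_mult H.swap_unit scal_S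
   H.mult_comult H.mult_counit H.unit_comult H.unit_counit H.scal_one H.scal_scal H.mult_scal H.unit_scal H.scal_comult H.scal_counit
   swap_swap H.mult_assoc[symmetric] H.comult_assoc[symmetric]

lemma comm_down: "j + ar t \<le> i \<Longrightarrow> ap t j (ap s i x) = ap s (i - ar t + coar t) (ap t j x)"
  using comm[of j t "i - ar t + coar t" s x] by simp

text \<open>
  Independent generators are sorted: counits innermost, then comultiplications, scalars, swaps,
  multiplications and units, and equal generators by position. Instantiating the two commutation
  rules keeps the rewriting terminating.
\<close>

lemmas commute_simps =
  comm[where t="\<epsilon>\<^sub>b" and s="\<epsilon>\<^sub>b"]
  comm[where t="\<epsilon>\<^sub>b" and s="\<Delta>\<^sub>b"]
  comm_down[where t="\<epsilon>\<^sub>b" and s="\<Delta>\<^sub>b"]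
  comm[where t="\<epsilon>\<^sub>b" and s="scal k'" for k']
  comm_down[where t="\<epsilon>\<^sub>b" and s="scal k'" for k']
  comm[where t="\<epsilon>\<^sub>b" and s="Swap"]
  comm_down[where t="\<epsilon>\<^sub>b" and s="Swap"]
  comm[where t="\<epsilon>\<^sub>b" and s="\<mu>\<^sub>w"]
  comm_down[where t="\<epsilon>\<^sub>b" and s="\<mu>\<^sub>w"]
  comm[where t="\<epsilon>\<^sub>b" and s="\<eta>\<^sub>w"]
  comm_down[where t="\<epsilon>\<^sub>b" and s="\<eta>\<^sub>w"]
  comm[where t="\<Delta>\<^sub>b" and s="\<Delta>\<^sub>b"]
  comm[where t="\<Delta>\<^sub>b" and s="scal k'" for k']
  comm_down[where t="\<Delta>\<^sub>b" and s="scal k'" for k']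
  comm[where t="\<Delta>\<^sub>b" and s="Swap"]
  comm_down[where t="\<Delta>\<^sub>b" and s="Swap"]
  comm[where t="\<Delta>\<^sub>b" and s="\<mu>\<^sub>w"]
  comm_down[where t="\<Delta>\<^sub>b" and s="\<mu>\<^sub>w"]
  comm[where t="\<Delta>\<^sub>b" and s="\<eta>\<^sub>w"]
  comm_down[where t="\<Delta>\<^sub>b" and s="\<eta>\<^sub>w"]
  comm[where t="scal k" and s="scal k'" for k k']
  comm[where t="scal k" and s="Swap" for k]
  comm_down[where t="scal k" and s="Swap" for k]
  comm[where t="scal k" and s="\<mu>\<^sub>w" for k]
  comm_down[where t="scal k" and s="\<mu>\<^sub>w" for k]
  comm[where t="scal k" and s="\<eta>\<^sub>w" for k]
  comm_down[where t="scal k" and s="\<eta>\<^sub>w" for k]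
  comm[where t="Swap" and s="Swap"]
  comm[where t="Swap" and s="\<mu>\<^sub>w"]
  comm_down[where t="Swap" and s="\<mu>\<^sub>w"]
  comm[where t="Swap" and s="\<eta>\<^sub>w"]
  comm_down[where t="Swap" and s="\<eta>\<^sub>w"]
  comm[where t="\<mu>\<^sub>w" and s="\<mu>\<^sub>w"]
  comm[where t="\<mu>\<^sub>w" and s="\<eta>\<^sub>w"]
  comm_down[where t="\<mu>\<^sub>w" and s="\<eta>\<^sub>w"]
  comm[where t="\<eta>\<^sub>w" and s="\<eta>\<^sub>w"]

lemma T_SS: "a \<in> carrier R \<Longrightarrow> b \<in> carrier R \<Longrightarrow> Suc (Suc i) < w x
    \<Longrightarrow> T i (S a i (S b (Suc i) x)) = S a (Suc i) (S b i (T i x))"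
  using T_S[of a i "S b (Suc i) x"] by (simp add: H.swap_scal)

text \<open>Nested comultiplications are normalised to the leftmost wire, which hides
  cocommutativity of the remaining copies from \<open>H.comult_comm\<close>. The rules collected in
  \<open>symmetry_simps\<close> supply such missing cases, for multiplications and braids as
  well.\<close>

lemma SS_DD: "a \<in> carrier R \<Longrightarrow> b \<in> carrier R \<Longrightarrow> Suc i < w x
    \<Longrightarrow> T (Suc i) (S a (Suc i) (S b (Suc (Suc i)) (D i (D i x)))) = S b (Suc i) (S a (Suc (Suc i)) (D i (D i x)))"
  by (simp add: T_SS comm H.comult_assoc H.comult_comm)

lemma SS_DDD: "a \<in> carrier R \<Longrightarrow> b \<in> carrier R \<Longrightarrow> Suc (Suc i) < w x
    \<Longrightarrow> T (Suc i) (S a (Suc i) (S b (Suc (Suc i)) (D i (D i (D (Suc i) x))))) = S b (Suc i) (S a (Suc (Suc i)) (D i (D i (D (Suc i) x))))"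
  by (simp add: T_SS comm H.comult_assoc H.comult_comm)

lemma MM_T1: "M i (M i (T (Suc i) x)) = M i (M i x)"
  by (simp add: H.mult_assoc H.mult_comm)

lemma MM_T2: "M i (M (Suc (Suc i)) (T i x)) = M i (M (Suc (Suc i)) x)"
proof -
  have "M i (M (Suc (Suc i)) (T i x)) = M (Suc i) (M i (T i x))"
    using comm[of i \<mu>\<^sub>w "Suc i" \<mu>\<^sub>w "T i x"] by simp
  also have "\<dots> = M i (M (Suc (Suc i)) x)"
    using comm[of i \<mu>\<^sub>w "Suc i" \<mu>\<^sub>w x] by (simp add: H.mult_comm)
  finally show ?thesis .
qed

lemma MMM_T1: "M i (M i (M (Suc (Suc i)) (T (Suc i) x))) = M i (M i (M (Suc (Suc i)) x))"
proof -
  have "M i (M i (M (Suc (Suc i)) z)) = M i (M i (M i z))" for z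
    using comm[of i \<mu>\<^sub>w "Suc i" \<mu>\<^sub>w z] by (simp add: H.mult_assoc[of i "M i z"])
  then show ?thesis by (simp add: MM_T1)
qed

lemma braid_3: "T (Suc (Suc i)) (T (Suc i) (T i (T (Suc (Suc i)) x))) = T (Suc i) (T (Suc (Suc i)) (T (Suc i) (T i x)))"
  using yang_baxter[of "Suc i" "T i x"] comm[of i Swap "Suc (Suc i)" Swap x] by simp

lemma braid_4: "T (Suc (Suc (Suc i))) (T (Suc (Suc i)) (T (Suc i) (T i (T (Suc (Suc (Suc i))) x)))) = T (Suc (Suc i)) (T (Suc (Suc (Suc i))) (T (Suc (Suc i)) (T (Suc i) (T i x))))"
  using braid_3[of "Suc i" "T i x"] comm[of i Swap "Suc (Suc (Suc i))" Swap x] by simp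

lemmas symmetry_simps = yang_baxter braid_3 braid_4 MM_T1 MM_T2 MMM_T1 SS_DD SS_DDD

section \<open>Pushing generators through one entry of a column\<close>

lemma comult_shear: "r \<in> carrier R \<Longrightarrow> Suc (Suc i) < w y \<Longrightarrow>
  D i (T i (shear r i y)) = T (Suc i) (shear r (Suc i) (T i (shear r i (D (Suc i) y))))"
  by (simp add: shear_def normalise commute_simps symmetry_simps)

lemma counit_shear: "r \<in> carrier R \<Longrightarrow> Suc (Suc i) < w y \<Longrightarrow>
  E i (T i (shear r i y)) = E (Suc i) y"
  by (simp add: shear_def normalise commute_simps)

lemma scal_shear: "r \<in> carrier R \<Longrightarrow> k \<in> carrier R \<Longrightarrow> Suc (Suc i) < w y \<Longrightarrow>
  S k i (T i (shear r i y)) = T i (shear (r \<otimes> k) i (S k (Suc i) y))"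
  by (simp add: shear_def normalise commute_simps)

lemma swap_shear: assumes "r \<in> carrier R" "q \<in> carrier R" "Suc (Suc (Suc i)) < w y"
  shows "T i (T (Suc i) (shear q (Suc i) (T i (shear r i y)))) = T (Suc i) (shear r (Suc i) (T i (shear q i (T (Suc i) y))))"
proof -
  \<comment> \<open>\<open>SS_DD\<close> read backwards: a swap has to be created here, so the rule
    itself is withheld from the simplifier.\<close>
  have 1: "S q (Suc i) (S r (Suc (Suc i)) (D i (D i y))) = T (Suc i) (S r (Suc i) (S q (Suc (Suc i)) (D i (D i y))))"
    using assms by (simp add: SS_DD)
  show ?thesis
    using assms by (simp add: shear_def normalise commute_simps symmetry_simps del: SS_DD)
      (simp add: 1 normalise commute_simps symmetry_simps del: SS_DD)
qed

lemma mult_shear: assumes "r \<in> carrier R" "q \<in> carrier R" "Suc (Suc (Suc i)) < w y"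
  shows "M i (T (Suc i) (shear q (Suc i) (T i (shear r i y)))) = T i (shear (r \<oplus> q) i (M (Suc i) y))"
proof -
  have 1: "S q (Suc i) (S r (Suc (Suc i)) (D i (D i y))) = T (Suc i) (S r (Suc i) (S q (Suc (Suc i)) (D i (D i y))))"
    using assms by (simp add: SS_DD)
  \<comment> \<open>\<open>scal_add\<close> read backwards splits the entry into two scalars on
    further copies, bracketed by coassociativity.\<close>
  have 2: "S (r \<oplus> q) (Suc i) (D i y) = M (Suc i) (S r (Suc i) (S q (Suc (Suc i)) (D i (D i y))))"
    using assms by (simp add: H.scal_add[symmetric] H.comult_assoc commute_simps)
  show ?thesis
    using assms by (simp add: shear_def normalise commute_simps 1 2 symmetry_simps del: SS_DD)
qed

lemma w_shear [simp]: "\<lbrakk>r \<in> carrier R; Suc (Suc i) < w x\<rbrakk> \<Longrightarrow> w (shear r i x) = w x"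
  by (simp add: shear_def)

lemma shear_below: "j + ar t \<le> i \<Longrightarrow> ap t j (shear r i x) = shear r (i - ar t + coar t) (ap t j x)"
  by (simp add: shear_def comm_down Suc_diff_le)

lemma shear_above: "Suc (Suc i) \<le> j \<Longrightarrow> ap t j (shear r i x) = shear r i (ap t j x)"
  by (simp add: shear_def comm)

lemma shear_zero: "Suc (Suc i) < w x \<Longrightarrow> shear \<zero> i x = x"
  by (simp add: shear_def H.scal_zero normalise commute_simps)

lemma unit_shear: "Suc i < w y \<Longrightarrow> T i (shear \<zero> i (U (Suc i) y)) = U i y"
  by (simp add: shear_zero H.swap_unit)

text \<open>
  \<open>act i v\<close> is \<open>(t, y) \<mapsto> y + t v\<close> with \<open>t\<close> on wire \<open>i\<close> and \<open>y\<close> on the \<open>length v\<close> wires after it.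
  \<open>mat i f m\<close> is the matrix with list of columns \<open>f\<close> and \<open>m\<close> rows, applied at wire \<open>i\<close>.
\<close>

fun act :: "nat \<Rightarrow> 'r list \<Rightarrow> 'x \<Rightarrow> 'x" where
  "act i [] x = E i x"
| "act i (r # v) x = act (Suc i) v (T i (shear r i x))"

fun mat :: "nat \<Rightarrow> 'r list list \<Rightarrow> nat \<Rightarrow> 'x \<Rightarrow> 'x" where
  "mat i [] m x = (U i ^^ m) x"
| "mat i (v # f) m x = act i v (mat (Suc i) f m x)"

abbreviation "cols m \<equiv> {v. set v \<subseteq> carrier R \<and> length v = m}"

lemma w_U_pow [simp]: "i < w x \<Longrightarrow> w ((U i ^^ m) x) = w x + m"
  by (induction m) auto

lemma w_act [simp]: "\<lbrakk>set v \<subseteq> carrier R; Suc (i + length v) < w x\<rbrakk> \<Longrightarrow> w (act i v x) = w x - Suc 0"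
  by (induction v arbitrary: i x) auto

lemma w_mat [simp]: "\<lbrakk>set f \<subseteq> cols m; i + length f < w x\<rbrakk> \<Longrightarrow> w (mat i f m x) = w x + m - length f"
  by (induction f arbitrary: i) auto

lemma U_pow_below: "j + ar t \<le> i \<Longrightarrow> ap t j ((U i ^^ m) x) = (U (i - ar t + coar t) ^^ m) (ap t j x)"
  by (induction m) (auto simp: comm_down)

lemma act_below: "j + ar t \<le> i \<Longrightarrow> ap t j (act i v x) = act (i - ar t + coar t) v (ap t j x)"
  by (induction v arbitrary: i x) (auto simp: comm_down shear_below Suc_diff_le)

lemma mat_below: "j + ar t \<le> i \<Longrightarrow> ap t j (mat i f m x) = mat (i - ar t + coar t) f m (ap t j x)"
  by (induction f arbitrary: i) (auto simp: U_pow_below act_below Suc_diff_le)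

section \<open>Closure of matrices under the Hopf algebra generators\<close>

inductive ha_op :: "('r ha_gen + 'r ha_gen) tm \<Rightarrow> bool" where
  "ha_op \<Delta>\<^sub>b" | "ha_op \<epsilon>\<^sub>b" | "ha_op \<mu>\<^sub>w" | "ha_op \<eta>\<^sub>w" | "k \<in> carrier R \<Longrightarrow> ha_op (scal k)" | "ha_op Swap"

text \<open>Rows before \<open>a\<close> are passed by \<open>comm\<close>; at row \<open>a\<close>
  the shear lemmas copy, delete, add, insert, multiply or exchange entries. The column
  \<open>v'\<close> is chosen before \<open>y\<close>, and the generator reappears one wire further
  right, since the variable of the column still occupies wire \<open>i\<close>.\<close>

lemma act_ha_op:
  assumes "ha_op t" "v \<in> cols m" "a + ar t \<le> m"
  shows "\<exists>v' \<in> cols (m + coar t - ar t). \<forall>y. Suc (i + m) < w y \<longrightarrow> ap t (i + a) (act i v y) = act i v' (ap t (Suc (i + a)) y)"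
  using assms(2,3)
proof (induction a arbitrary: i v m)
  case (Suc a)
  then obtain r v1 m1 where v: "v = r # v1" "r \<in> carrier R" "v1 \<in> cols m1" "m = Suc m1"
    by (cases v) auto
  then obtain v1' where v1': "v1' \<in> cols (m1 + coar t - ar t)"
    "\<And>y. Suc (Suc i + m1) < w y \<Longrightarrow> ap t (Suc i + a) (act (Suc i) v1 y) = act (Suc i) v1' (ap t (Suc (Suc i + a)) y)"
    using Suc.IH[of v1 m1 "Suc i"] Suc.prems by auto
  show ?case
  proof (intro bexI[of _ "r # v1'"] allI impI)
    show "r # v1' \<in> cols (m + coar t - ar t)"
      using v v1'(1) Suc.prems by auto
    show "ap t (i + Suc a) (act i v y) = act i (r # v1') (ap t (Suc (i + Suc a)) y)" if "Suc (i + m) < w y" for y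
      using v v1'(2)[of "T i (shear r i y)"] that by (simp add: comm shear_above)
  qed
next
  case 0
  from assms(1) show ?case
  proof cases
    case 1
    with 0 obtain r v1 where v: "v = r # v1" "r \<in> carrier R" "set v1 \<subseteq> carrier R" "m = Suc (length v1)" by (cases v) auto
    show ?thesis
      by (intro bexI[of _ "r # r # v1"]) (use v 1 in \<open>auto simp: act_below comult_shear\<close>)
  next
    case 2
    with 0 obtain r v1 where v: "v = r # v1" "r \<in> carrier R" "set v1 \<subseteq> carrier R" "m = Suc (length v1)" by (cases v) auto
    show ?thesis
      by (intro bexI[of _ v1]) (use v 2 in \<open>auto simp: act_below counit_shear\<close>)
  next
    case 3
    with 0 obtain r q v1 where v: "v = r # q # v1" "r \<in> carrier R" "q \<in> carrier R" "set v1 \<subseteq> carrier R" "m = Suc (Suc (length v1))"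
      by (cases v; cases "tl v") auto
    show ?thesis
      by (intro bexI[of _ "(r \<oplus> q) # v1"]) (use v 3 in \<open>auto simp: act_below mult_shear\<close>)
  next
    case 4
    show ?thesis
      by (intro bexI[of _ "\<zero> # v"]) (use 0 4 in \<open>auto simp: act_below unit_shear\<close>)
  next
    case (5 k)
    with 0 obtain r v1 where v: "v = r # v1" "r \<in> carrier R" "set v1 \<subseteq> carrier R" "m = Suc (length v1)" by (cases v) auto
    show ?thesis
      by (intro bexI[of _ "(r \<otimes> k) # v1"]) (use v 5 in \<open>auto simp: act_below scal_shear\<close>)
  next
    case 6
    with 0 obtain r q v1 where v: "v = r # q # v1" "r \<in> carrier R" "q \<in> carrier R" "set v1 \<subseteq> carrier R" "m = Suc (Suc (length v1))"
      by (cases v; cases "tl v") auto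
    show ?thesis
      by (intro bexI[of _ "q # r # v1"]) (use v 6 in \<open>auto simp: act_below swap_shear\<close>)
  qed
qed

text \<open>A matrix without columns consists of zero rows, and a generator attached to units leaves
  only units.\<close>

lemma U_pow_ha_op:
  assumes "ha_op t" "a + ar t \<le> m" "i < w x"
  shows "ap t (i + a) ((U i ^^ m) x) = (U i ^^ (m + coar t - ar t)) x"
  using assms(2)
proof (induction a arbitrary: m)
  case (Suc a)
  then obtain m1 where "m = Suc m1" by (cases m) auto
  with Suc show ?case by (auto simp: comm Suc_diff_le)
next
  case 0
  have U2: "\<exists>m1. m = Suc (Suc m1)" if "Suc (Suc 0) \<le> m"
    using that by (metis Suc_le_D Suc_le_mono)
  have U1: "\<exists>m1. m = Suc m1" if "Suc 0 \<le> m"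
    using that by (metis Suc_le_D)
  from assms(1) show ?case
  proof cases
    case 1
    with U1 0 show ?thesis by (auto simp: H.unit_comult)
  next
    case 2
    with U1 0 assms(3) show ?thesis by (auto simp: H.unit_counit)
  next
    case 3
    with U2 0 assms(3) show ?thesis by (auto simp: H.mult_unit)
  next
    case 4
    then show ?thesis by simp
  next
    case (5 k)
    with U1 0 show ?thesis by (auto simp: H.unit_scal)
  next
    case 6
    with U2 0 assms(3) show ?thesis by (auto simp: T_U comm)
  qed
qed

text \<open>Matrices are closed under post-composition: the generator passes the columns one by one
  and is finally absorbed by the units.\<close>

lemma mat_ha_op:
  assumes "ha_op t" "set f \<subseteq> cols m" "a + ar t \<le> m"
  shows "\<exists>f'. length f' = length f \<and> set f' \<subseteq> cols (m + coar t - ar t) \<and>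
    (\<forall>x. i + length f < w x \<longrightarrow> ap t (i + a) (mat i f m x) = mat i f' (m + coar t - ar t) x)"
  using assms(2)
proof (induction f arbitrary: i)
  case Nil
  show ?case
    by (intro exI[of _ "[]"]) (use assms in \<open>auto simp: U_pow_ha_op\<close>)
next
  case (Cons v f)
  then have v: "v \<in> cols m" and f: "set f \<subseteq> cols m" by auto
  from Cons.IH[OF f, of "Suc i"] obtain f' where f': "length f' = length f" "set f' \<subseteq> cols (m + coar t - ar t)"
      "\<And>x. Suc i + length f < w x \<Longrightarrow> ap t (Suc i + a) (mat (Suc i) f m x) = mat (Suc i) f' (m + coar t - ar t) x"
    by blast
  from act_ha_op[OF assms(1) v assms(3), of i] obtain v' where v': "v' \<in> cols (m + coar t - ar t)"
      "\<And>y. Suc (i + m) < w y \<Longrightarrow> ap t (i + a) (act i v y) = act i v' (ap t (Suc (i + a)) y)"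
    by blast
  have "ap t (i + a) (mat i (v # f) m x) = mat i (v' # f') (m + coar t - ar t) x" if "i + length (v # f) < w x" for x
  proof -
    have "Suc (i + m) < w (mat (Suc i) f m x)"
      using that f by simp
    then have "ap t (i + a) (mat i (v # f) m x) = act i v' (ap t (Suc (i + a)) (mat (Suc i) f m x))"
      using v'(2) by simp
    then show ?thesis
      using f'(3)[of x] that by simp
  qed
  moreover have "length (v' # f') = length (v # f)" "set (v' # f') \<subseteq> cols (m + coar t - ar t)"
    using f'(1,2) v'(1) by simp_all
  ultimately show ?case by blast
qed

text \<open>The columns of the identity matrix.\<close>

fun unit_cols :: "nat \<Rightarrow> 'r list list" where
  "unit_cols 0 = []"
| "unit_cols (Suc n) = (\<one> # replicate n \<zero>) # map (Cons \<zero>) (unit_cols n)"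

lemma unit_cols: "length (unit_cols n) = n" "set (unit_cols n) \<subseteq> cols n"
  by (induction n) (auto simp: subset_iff)

lemma mat_zero_row:
  "\<lbrakk>set f \<subseteq> cols m; i + length f < w x\<rbrakk> \<Longrightarrow> mat i (map (Cons \<zero>) f) (Suc m) x = U i (mat i f m x)"
  by (induction f arbitrary: i) (auto simp: unit_shear act_below)

lemma act_zeros: "Suc (i + n) < w x \<Longrightarrow> act i (replicate n \<zero>) x = E i x"
  by (induction n arbitrary: i x) (auto simp: shear_zero T_E)

text \<open>Starts the matrix form in \<open>factored_mat\<close>. The later columns have a zero
  first row, which becomes a unit; the first column adds its variable to that unit and is then
  discarded by its zeros.\<close>

lemma mat_unit_cols: "i + n < w x \<Longrightarrow> mat i (unit_cols n) n x = x"
proof (induction n arbitrary: i)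
  case (Suc n)
  let ?y = "mat (Suc i) (unit_cols n) n x"
  have y: "?y = x" using Suc by simp
  have "mat i (unit_cols (Suc n)) (Suc n) x = act (Suc i) (replicate n \<zero>) (T i (shear \<one> i (U (Suc i) ?y)))"
    using mat_zero_row[of "unit_cols n" n "Suc i" x] unit_cols[of n] Suc.prems by simp
  also have "\<dots> = E (Suc i) (T i (shear \<one> i (U (Suc i) x)))"
    unfolding y using Suc.prems by (intro act_zeros) simp
  also have "\<dots> = x"
    using Suc.prems by (simp add: shear_def normalise commute_simps)
  finally show ?case .
qed simp

section \<open>Consequences of the interaction laws\<close>

lemma minus_one: "\<ominus> \<one> \<in> carrier R" "\<ominus> \<one> \<noteq> \<zero>" "\<ominus> \<one> \<otimes> \<ominus> \<one> = \<one>"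
  using one_not_zero by (auto simp: l_minus r_minus)

lemma shear_shear:
  assumes "q \<in> carrier R" "r \<in> carrier R" "Suc (Suc i) < w x"
  shows "shear q i (shear r i x) = shear (q \<oplus> r) i x"
proof -
  have "S (q \<oplus> r) (Suc i) (D i x) = M (Suc i) (S q (Suc i) (S r (Suc (Suc i)) (D i (D i x))))"
    using assms by (simp add: H.scal_add[symmetric] H.comult_assoc)
  then show ?thesis
    using assms by (simp add: shear_def normalise commute_simps symmetry_simps)
qed

lemma shear_cancel:
  assumes "q \<in> carrier R" "Suc (Suc i) < w x"
  shows "shear q i (shear (\<ominus> q) i x) = x" "shear (\<ominus> q) i (shear q i x) = x"
  using assms by (simp_all add: shear_shear shear_zero r_neg l_neg)

text \<open>In coordinates, both sides send \<open>(a, b, c)\<close> to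
  \<open>(b, c + q r a + r b, r a)\<close>.\<close>

lemma shear_swap_scal:
  assumes "q \<in> carrier R" "r \<in> carrier R" "Suc (Suc (Suc i)) < w v"
  shows "shear r i (T (Suc i) (shear q (Suc i) (S r (Suc i) (T i v)))) =
    T (Suc i) (T i (S r i (shear r (Suc i) (T i (shear (r \<otimes> q) (Suc i) (T i v))))))"
  using assms by (simp add: shear_def normalise commute_simps symmetry_simps m_comm)

text \<open>The commutator relation of elementary matrices: both sides send \<open>(a, b, c)\<close>
  to \<open>(a, b + q a, c + r b + r q a)\<close>.\<close>

lemma shear_commutator:
  assumes "q \<in> carrier R" "r \<in> carrier R" "Suc (Suc (Suc i)) < w v"
  shows "shear q i (shear r (Suc i) (T i (shear (r \<otimes> q) (Suc i) (T i v)))) = shear r (Suc i) (shear q i v)"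
  using assms by (simp add: shear_def normalise commute_simps symmetry_simps m_comm)

text \<open>With \<open>(u', t', c)\<close> on the wires, \<open>u = r u'\<close> and
  \<open>t = t' - q u'\<close> give \<open>c + q u + r t = c + r t'\<close>, so \<open>u'\<close>
  drops out of the equation.\<close>

lemma shear_eliminate:
  assumes "q \<in> carrier R" "r \<in> carrier R" "Suc (Suc (Suc i)) < w y"
  shows "shear r i (T (Suc i) (shear q (Suc i) (S r (Suc i) (T i (shear (\<ominus> q) i y))))) =
    T (Suc i) (T i (S r i (shear (\<ominus> q) i (shear r (Suc i) y))))"
proof -
  \<comment> \<open>Inverting the first shear expresses both sides through \<open>v\<close>, to
    which the two preceding identities apply.\<close>
  define v where "v = shear (\<ominus> q) i y"
  have v: "Suc (Suc (Suc i)) < w v" "shear q i v = y"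
    using assms by (simp_all add: v_def shear_cancel)
  have "shear (\<ominus> q) i (shear r (Suc i) y) = shear r (Suc i) (T i (shear (r \<otimes> q) (Suc i) (T i v)))"
    using assms shear_commutator[OF assms(1,2) v(1)] shear_cancel(2)[of q i "shear r (Suc i) (T i (shear (r \<otimes> q) (Suc i) (T i v)))"] v
    by simp
  then show ?thesis
    using shear_swap_scal[OF assms(1,2) v(1)] by (simp add: v_def)
qed

section \<open>Relations between the two colours\<close>

lemma mult_unit_op': "Suc i < w x \<Longrightarrow> M' i (U' (Suc i) x) = x"
  using G.mult_unit[of i x] G.mult_comm[of i "U' (Suc i) x"] by (simp add: G.swap_unit)

lemma scal_op_minus_one: "Suc i < w x \<Longrightarrow> S' (\<ominus> \<one>) i x = S (\<ominus> \<one>) i x"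
  using scal_scal_op[of "\<ominus> \<one>" i "S (\<ominus> \<one>) i x"] minus_one
  by (simp add: H.scal_scal H.scal_one)

lemma scal_minus_one_twice: "Suc i < w x \<Longrightarrow> S (\<ominus> \<one>) i (S (\<ominus> \<one>) i x) = x"
  by (simp add: H.scal_scal minus_one H.scal_one)

text \<open>For \<open>r \<noteq> 0\<close> the opposite scalar undoes \<open>S r i x\<close>, and
  \<open>\<epsilon>\<^sub>w\<close> absorbs the opposite scalar.\<close>

lemma counit_scal: "\<lbrakk>r \<in> carrier R; r \<noteq> \<zero>; Suc i < w x\<rbrakk> \<Longrightarrow> E' i (S r i x) = E' i x"
  using G.scal_counit[of r i "S r i x"] by (simp add: scal_scal_op)

lemma unit_op_scal: "\<lbrakk>r \<in> carrier R; r \<noteq> \<zero>; i < w x\<rbrakk> \<Longrightarrow> S r i (U' i x) = U' i x"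
  using scal_op_scal[of r i "U' i x"] by (simp add: G.unit_scal)

lemma cap_unit: "Suc i < w x \<Longrightarrow> E i (M' i (U (Suc i) x)) = E' i x"
  using cap[of i "U (Suc i) x"] by (simp add: H.unit_scal minus_one mult_unit')

text \<open>By the black Frobenius law, copying the output amounts to copying the unit, that is, to
  adding a fresh unit. Discarding the original copy leaves that fresh unit, and
  \<open>cap_unit\<close> identifies the rest.\<close>

lemma merge_unit:
  assumes "Suc i < w x"
  shows "M' i (U (Suc i) x) = U i (E' i x)"
proof -
  have "D i (M' i (U (Suc i) x)) = U (Suc i) (M' i (U (Suc i) x))"
    by (simp add: frobenius_b2[symmetric] H.unit_comult comm)
  then have "E i (D i (M' i (U (Suc i) x))) = U i (E i (M' i (U (Suc i) x)))"
    by (simp add: comm)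
  with assms show ?thesis by (simp add: H.comult_counit cap_unit)
qed

text \<open>If one of two copies must vanish, so must the other. The counit is rewritten by
  \<open>cap_unit\<close>, and the Frobenius law reduces the claim to
  \<open>merge_unit\<close>.\<close>

lemma counit_comult:
  assumes "Suc i < w x"
  shows "E' (Suc i) (D i x) = U i (E' i x)"
proof -
  have "E' (Suc i) (D i x) = E (Suc i) (M' (Suc i) (U (Suc (Suc i)) (D i x)))"
    using assms by (simp add: cap_unit)
  also have "\<dots> = E (Suc i) (D i (M' i (U (Suc i) x)))"
    using assms by (simp add: frobenius_b1[symmetric] comm)
  finally show ?thesis
    using assms by (simp add: comult_counit' merge_unit)
qed

text \<open>As a relation, \<open>\<Delta>\<^sub>w\<close> sends \<open>x\<close> to
  \<open>(a, x - a)\<close> with \<open>a\<close> arbitrary. This is the white Frobenius law with a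
  unit on the first input and the white cup replaced by the black one.\<close>

lemma comult_op_eq: "Suc i < w x \<Longrightarrow> D' i x = M (Suc i) (S (\<ominus> \<one>) (Suc i) (D i (U' i x)))"
  using frobenius_w1[of i "U i x"] by (simp add: H.mult_unit cup)

text \<open>\<open>\<eta>\<^sub>b\<close> absorbs \<open>r\<close>, so both legs of the cup may be
  scaled by \<open>r\<close>; cancelling on one leg transposes the scalar to the other.\<close>

lemma scal_cup:
  assumes "r \<in> carrier R" "r \<noteq> \<zero>" "i < w x"
  shows "S' r i (D i (U' i x)) = S r (Suc i) (D i (U' i x))"
proof -
  have "D i (U' i x) = S r i (S r (Suc i) (D i (U' i x)))"
    using assms H.scal_comult[of r i "U' i x"] by (simp add: unit_op_scal)
  then show ?thesis
    using assms scal_scal_op[of r i "S r (Suc i) (D i (U' i x))"] by simp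
qed

text \<open>This puts nonzero shears into the opposite PROP: \<open>y\<close> is split into
  \<open>(a, y - a)\<close>, \<open>a\<close> is written as \<open>q b\<close>, and
  \<open>\<mu>\<^sub>b\<close> identifies \<open>b\<close> with \<open>t\<close>, which leaves
  \<open>y - q t\<close>.\<close>

lemma shear_op:
  assumes "q \<in> carrier R" "q \<noteq> \<zero>" "Suc (Suc i) < w x"
  shows "M' i (S' q (Suc i) (D' (Suc i) x)) = shear (\<ominus> q) i x"
proof -
  have "M' i (S' q (Suc i) (D' (Suc i) x))
      = M (Suc i) (S (\<ominus> \<one>) (Suc i) (M' i (S' q (Suc i) (D (Suc i) (U' (Suc i) x)))))"
    using assms by (simp add: comult_op_eq comm_down)
  also have "\<dots> = M (Suc i) (S (\<ominus> \<one>) (Suc i) (S q (Suc i) (D i x)))"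
    using assms by (simp add: scal_cup comm_down frobenius_b2 mult_unit_op')
  finally show ?thesis
    using assms minus_one by (simp add: shear_def H.scal_scal r_minus)
qed

text \<open>Identifying \<open>t\<close> and \<open>y\<close> is the equation
  \<open>y - t = 0\<close>. The sign of the shear and the sign from \<open>cap\<close> combine into
  a common one, which the black counit discards.\<close>

lemma mult_op_eq:
  assumes "Suc (Suc i) < w x"
  shows "E' (Suc i) (shear (\<ominus> \<one>) i x) = M' i x"
proof -
  have "M' (Suc i) (S (\<ominus> \<one>) (Suc i) (S (\<ominus> \<one>) (Suc (Suc i)) (D i x))) = S (\<ominus> \<one>) (Suc i) (M' (Suc i) (D i x))"
    using assms G.mult_scal[of "\<ominus> \<one>" "Suc i" "D i x"] by (simp add: scal_op_minus_one minus_one)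
  then have "E' (Suc i) (shear (\<ominus> \<one>) i x) = E (Suc i) (D i (M' i x))"
    using assms by (simp add: shear_def cap minus_one comm H.scal_counit frobenius_b1)
  then show ?thesis
    using assms by (simp add: comult_counit')
qed

lemma scal_op_comult:
  assumes "r \<in> carrier R" "r \<noteq> \<zero>" "Suc i < w x"
  shows "D i (S' r i x) = S' r i (S' r (Suc i) (D i x))"
proof -
  have "D i x = S r i (S r (Suc i) (D i (S' r i x)))"
    using assms H.scal_comult[of r i "S' r i x"] by (simp add: scal_op_scal)
  then have "S' r i (S' r (Suc i) (D i x)) = S' r i (S r i (S' r (Suc i) (S r (Suc i) (D i (S' r i x)))))"
    by (simp add: comm)
  then show ?thesis
    using assms by (simp add: scal_scal_op)
qed

text \<open>Dividing \<open>x\<close> by \<open>r\<close> introduces an arbitrary \<open>t\<close>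
  subject to \<open>x - r t = 0\<close>. Pulling the opposite scalar out of the shear reduces this
  to \<open>mult_op_eq\<close>.\<close>

lemma scal_op_eq:
  assumes "r \<in> carrier R" "r \<noteq> \<zero>" "Suc i < w x"
  shows "E' (Suc i) (shear (\<ominus> r) i (U' i x)) = S' r i x"
proof -
  have "S (\<ominus> r) (Suc i) (S' r (Suc i) y) = S (\<ominus> \<one>) (Suc i) y" if "Suc (Suc i) < w y" for y
    using that assms minus_one H.scal_scal[of r "\<ominus> \<one>" "Suc i" "S' r (Suc i) y"]
    by (simp add: r_minus scal_op_scal)
  then have "shear (\<ominus> r) i (S' r i (U' i x)) = S' r i (shear (\<ominus> \<one>) i (U' i x))"
    using assms by (simp add: shear_def scal_op_comult comm_down)
  then have "E' (Suc i) (shear (\<ominus> r) i (U' i x)) = S' r i (E' (Suc i) (shear (\<ominus> \<one>) i (U' i x)))"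
    using assms by (simp add: G.unit_scal comm)
  then show ?thesis
    using assms by (simp add: mult_op_eq G.mult_unit)
qed

text \<open>Expand \<open>\<Delta>\<^sub>w\<close> in \<open>\<Delta>\<^sub>w ;; \<mu>\<^sub>w = Id1\<close>: the bone splits off next to an identity wire.\<close>

lemma counit_unit_op_aux:
  assumes "Suc i < w x"
  shows "E i (U' i x) = x"
proof -
  have "M i (S \<one> i (S (\<ominus> \<one>) (Suc i) (D i (U' i x)))) = S \<zero> i (U' i x)"
    by (simp add: H.scal_add r_neg)
  then have "S \<zero> i (U' i x) = M i (S (\<ominus> \<one>) (Suc i) (D i (U' i x)))"
    using assms minus_one by (simp add: H.scal_one)
  moreover have "M i (D' i x) = M i (M i (S (\<ominus> \<one>) (Suc i) (D i (U' i x))))"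
    using assms by (simp add: comult_op_eq H.mult_assoc)
  ultimately have "x = M i (S \<zero> i (U' i x))"
    using assms by (simp add: special_w)
  then show ?thesis
    using assms by (simp add: H.scal_zero H.mult_unit)
qed

text \<open>\<open>counit_unit_op_aux\<close> needs a wire next to the bone. An auxiliary
  \<open>\<eta>\<^sub>b\<close> provides one and is cancelled by \<open>\<epsilon>\<^sub>w\<close>
  afterwards.\<close>

lemma counit_unit_op:
  assumes "i < w x"
  shows "E i (U' i x) = x"
proof -
  have "U' i (E i (U' i x)) = E i (U' (Suc i) (U' i x))"
    using comm[of i \<epsilon>\<^sub>b i \<eta>\<^sub>b "U' i x"] by simp
  also have "\<dots> = E i (U' i (U' i x))"
    using comm[of i \<eta>\<^sub>b "Suc i" \<eta>\<^sub>b x] by simp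
  also have "\<dots> = U' i x"
    using assms by (simp add: counit_unit_op_aux)
  finally have "U' i (E i (U' i x)) = U' i x" .
  then show ?thesis
    using assms G.unit_counit[of i "E i (U' i x)"] by (simp add: G.unit_counit)
qed

text \<open>The white bone is reduced to the black one:
  \<open>\<Delta>\<^sub>w ;; \<mu>\<^sub>w\<close> is inserted in its middle, \<open>cup\<close> and
  \<open>cap\<close> recolour both halves, and the two signs cancel.\<close>

lemma counit_op_unit:
  assumes "i < w x"
  shows "E' i (U i x) = x"
proof -
  have "E' i (U i x) = E' i (M i (D' i (U i x)))"
    using assms by (simp add: special_w)
  also have "\<dots> = E i (M' i (D i (U' i x)))"
    using assms by (simp add: cap cup scal_minus_one_twice)
  finally show ?thesis
    using assms by (simp add: special_b counit_unit_op)
qed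

section \<open>Factorisation\<close>

inductive haop_op :: "('r ha_gen + 'r ha_gen) tm \<Rightarrow> bool" where
  "haop_op \<Delta>\<^sub>w" | "haop_op \<epsilon>\<^sub>w" | "haop_op \<mu>\<^sub>b" | "haop_op \<eta>\<^sub>b" | "k \<in> carrier R \<Longrightarrow> haop_op (scal_op k)" | "haop_op Swap"

inductive op_arrow :: "'x \<Rightarrow> 'x \<Rightarrow> bool" for x0 where
  base: "op_arrow x0 x0"
| step: "\<lbrakk>op_arrow x0 x; haop_op t; i + ar t < w x\<rbrakk> \<Longrightarrow> op_arrow x0 (ap t i x)"

text \<open>The class \<open>G\<close> of the overview, relative to the start state
  \<open>x0\<close>.\<close>

inductive factored :: "'x \<Rightarrow> 'x \<Rightarrow> bool" for x0 where
  base: "op_arrow x0 x \<Longrightarrow> factored x0 x"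
| step: "\<lbrakk>factored x0 x; ha_op t; i + ar t < w x\<rbrakk> \<Longrightarrow> factored x0 (ap t i x)"

lemma has_type_haop_op: "haop_op t \<Longrightarrow> has_type (IH R) t (ar t) (coar t)"
  by (induction rule: haop_op.induct) (use has_type_IH_gen has_type.swap in \<open>simp_all add: numeral_2_eq_2\<close>)

context
  fixes x0 :: 'x
  assumes x0: "0 < w x0"
begin

lemma op_arrow_width: "op_arrow x0 x \<Longrightarrow> 0 < w x"
  by (induction rule: op_arrow.induct) (use x0 width[OF has_type_haop_op] in auto)

lemma op_arrow_steps:
  "\<lbrakk>op_arrow x0 x; Suc i < w x\<rbrakk> \<Longrightarrow> op_arrow x0 (D' i x)" "\<lbrakk>op_arrow x0 x; Suc i < w x\<rbrakk> \<Longrightarrow> op_arrow x0 (E' i x)"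
  "\<lbrakk>op_arrow x0 x; Suc (Suc i) < w x\<rbrakk> \<Longrightarrow> op_arrow x0 (M' i x)" "\<lbrakk>op_arrow x0 x; i < w x\<rbrakk> \<Longrightarrow> op_arrow x0 (U' i x)"
  "\<lbrakk>k \<in> carrier R; op_arrow x0 x; Suc i < w x\<rbrakk> \<Longrightarrow> op_arrow x0 (S' k i x)" "\<lbrakk>op_arrow x0 x; Suc (Suc i) < w x\<rbrakk> \<Longrightarrow> op_arrow x0 (T i x)"
  by (rule op_arrow.step; auto intro: haop_op.intros)+

lemma factored_steps:
  "\<lbrakk>factored x0 x; Suc i < w x\<rbrakk> \<Longrightarrow> factored x0 (D i x)" "\<lbrakk>factored x0 x; Suc i < w x\<rbrakk> \<Longrightarrow> factored x0 (E i x)"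
  "\<lbrakk>factored x0 x; Suc (Suc i) < w x\<rbrakk> \<Longrightarrow> factored x0 (M i x)" "\<lbrakk>factored x0 x; i < w x\<rbrakk> \<Longrightarrow> factored x0 (U i x)"
  "\<lbrakk>k \<in> carrier R; factored x0 x; Suc i < w x\<rbrakk> \<Longrightarrow> factored x0 (S k i x)" "\<lbrakk>factored x0 x; Suc (Suc i) < w x\<rbrakk> \<Longrightarrow> factored x0 (T i x)"
  by (rule factored.step; auto intro: ha_op.intros)+

lemma op_arrow_shear:
  assumes "q \<in> carrier R" "op_arrow x0 x" "Suc (Suc i) < w x"
  shows "op_arrow x0 (shear q i x)"
\<comment> \<open>\<open>shear_op\<close> needs a nonzero coefficient; the zero shear is the
  identity.\<close>
proof (cases "q = \<zero>")
  case False
  then have "shear q i x = M' i (S' (\<ominus> q) (Suc i) (D' (Suc i) x))"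
    using assms shear_op[of "\<ominus> q" i x] by simp
  then show ?thesis
    using assms by (simp add: op_arrow_steps)
qed (use assms shear_zero in simp)

lemma factored_shear: "\<lbrakk>q \<in> carrier R; factored x0 x; Suc (Suc i) < w x\<rbrakk> \<Longrightarrow> factored x0 (shear q i x)"
  by (simp add: shear_def factored_steps)

lemma factored_act: "\<lbrakk>set v \<subseteq> carrier R; factored x0 x; Suc (i + length v) < w x\<rbrakk> \<Longrightarrow> factored x0 (act i v x)"
  by (induction v arbitrary: i x) (auto simp: factored_steps factored_shear)

lemma factored_U_pow: "\<lbrakk>factored x0 x; i < w x\<rbrakk> \<Longrightarrow> factored x0 ((U i ^^ m) x)"
  by (induction m) (auto simp: factored_steps)

text \<open>The Hopf algebra part of a factored state is a matrix: begin with the identity matrix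
  and absorb each generator by \<open>mat_ha_op\<close>.\<close>

lemma factored_mat:
  assumes "factored x0 y"
  obtains x c m where "op_arrow x0 x" "w x = Suc (length c)" "w y = Suc m" "set c \<subseteq> cols m" "y = mat 0 c m x"
proof -
  have "\<exists>x c m. op_arrow x0 x \<and> w x = Suc (length c) \<and> w y = Suc m \<and> set c \<subseteq> cols m \<and> y = mat 0 c m x"
    using assms
  proof (induction rule: factored.induct)
    case (base x)
    then obtain m where m: "w x = Suc m"
      using op_arrow_width gr0_conv_Suc by blast
    with base show ?case
      using unit_cols[of m] mat_unit_cols[of 0 m x]
      by (intro exI[of _ x] exI[of _ "unit_cols m"] exI[of _ m]) simp
  next
    case (step y t i)
    then obtain x c m where x: "op_arrow x0 x" "w x = Suc (length c)" "w y = Suc m" "set c \<subseteq> cols m" "y = mat 0 c m x"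
      by blast
    have "i + ar t \<le> m" using step.hyps(3) x(3) by simp
    from mat_ha_op[OF step.hyps(2) x(4) this, of 0] obtain c' where
      c': "length c' = length c" "set c' \<subseteq> cols (m + coar t - ar t)"
        "\<And>x. length c < w x \<Longrightarrow> ap t i (mat 0 c m x) = mat 0 c' (m + coar t - ar t) x"
      unfolding add_0 by blast
    have "ap t i y = mat 0 c' (m + coar t - ar t) x"
      using c'(3)[of x] x(2,5) by simp
    moreover from this have "w (ap t i y) = Suc (m + coar t - ar t)"
      using c' x by simp
    ultimately show ?case
      using c' x by (intro exI[of _ x] exI[of _ c'] exI[of _ "m + coar t - ar t"]) simp
  qed
  then show ?thesis using that by blast
qed

text \<open>
  The equation \<open>r t + q u + \<dots> = 0\<close> with \<open>r \<noteq> 0\<close>: substituting \<open>u = r u'\<close> and \<open>t = t' - q u'\<close>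
  eliminates \<open>u\<close>, and the substitution only involves invertible operations of the opposite part.
\<close>

lemma solve_unit:
  assumes "r \<in> carrier R" "r \<noteq> \<zero>" "op_arrow x0 x" "set c \<subseteq> cols (Suc k)" "Suc i + length c < w x"
  shows "factored x0 (E' (Suc i) (shear r i (mat (Suc i) c (Suc k) x)))"
  using assms(3-)
proof (induction c arbitrary: i x)
  case Nil
  \<comment> \<open>One of the \<open>k + 1\<close> zero rows is split off: it meets the shear,
    which becomes copying followed by \<open>r\<close>. The remaining equation
    \<open>r t = 0\<close> forces \<open>t = 0\<close>.\<close>
  define z where "z = (U (Suc i) ^^ k) x"
  have z: "Suc i < w z"
    using Nil by (simp add: z_def)
  have "shear r i (U (Suc i) z) = S r (Suc i) (D i z)"
    using z assms(1) by (simp add: shear_def normalise commute_simps)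
  then have "E' (Suc i) (shear r i (mat (Suc i) [] (Suc k) x)) = E' (Suc i) (D i z)"
    using z assms(1,2) by (simp add: z_def[symmetric] counit_scal)
  also have "\<dots> = U i ((U i ^^ k) (E' i x))"
    using z by (simp add: counit_comult) (simp add: z_def U_pow_below)
  finally show ?case
    using Nil by (simp add: factored_steps factored_U_pow factored.base op_arrow_steps)
next
  case (Cons v c)
  then obtain q v1 where v: "v = q # v1" "q \<in> carrier R" "set v1 \<subseteq> carrier R" "length v1 = k"
    by (cases v) auto
  have c: "set c \<subseteq> cols (Suc k)" using Cons.prems by simp
  define y where "y = mat (Suc (Suc i)) c (Suc k) x"
  \<comment> \<open>Inverse substitution: \<open>(t, u)\<close> becomes \<open>(u', t)\<close> with
    \<open>u = r u'\<close>, and then \<open>(u', t')\<close> with \<open>t' = t + q u'\<close>. So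
    \<open>t'\<close> stands on wire \<open>i + 1\<close>, where the induction hypothesis expects
    the pivot variable.\<close>
  define x' where "x' = shear q i (T i (S' r (Suc i) x))"
  define y' where "y' = mat (Suc (Suc i)) c (Suc k) x'"
  have w: "w y = w x + Suc k - length c" "w x' = w x"
    "w y' = w x + Suc k - length c" "Suc (Suc i) + length c < w x"
    using Cons.prems v assms(1) by (simp_all add: y_def x'_def y'_def)
  have "op_arrow x0 x'"
    using Cons.prems assms(1) v by (simp add: x'_def op_arrow_shear op_arrow_steps)
  \<comment> \<open>The substitution acts on wires to the left of the remaining columns, so it
    commutes with their matrix.\<close>
  have y': "y' = shear q i (T i (S' r (Suc i) y))"
    by (simp add: y'_def x'_def y_def mat_below shear_def)
  have "y = S r (Suc i) (T i (shear (\<ominus> q) i y'))"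
    using v w assms by (simp add: y' shear_cancel swap_swap scal_op_scal)
  then have "shear r i (T (Suc i) (shear q (Suc i) y)) =
      T (Suc i) (T i (S r i (shear (\<ominus> q) i (shear r (Suc i) y'))))"
    using shear_eliminate[of q r i y'] v w assms(1) by simp
  then have "E' (Suc i) (shear r i (T (Suc i) (shear q (Suc i) y))) =
      T i (S r i (shear (\<ominus> q) i (E' (Suc (Suc i)) (shear r (Suc i) y'))))"
    by (simp add: G.swap_counit comm shear_above)
  moreover have "E' (Suc i) (shear r i (mat (Suc i) (v # c) (Suc k) x)) =
      act (Suc i) v1 (E' (Suc i) (shear r i (T (Suc i) (shear q (Suc i) y))))"
    by (simp add: v y_def act_below shear_def)
  \<comment> \<open>Everything applied after the counit belongs to the Hopf algebra part, so only
    the shorter equation in the new variables is left.\<close>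
  moreover have "factored x0 (E' (Suc (Suc i)) (shear r (Suc i) y'))"
    unfolding y'_def using \<open>op_arrow x0 x'\<close> c w by (intro Cons.IH) auto
  ultimately show ?case
    using v w assms(1) by (simp add: factored_act factored_steps factored_shear)
qed

text \<open>The first row is scanned: a zero coefficient is skipped, a nonzero one becomes the pivot
  of \<open>solve_unit\<close>, and an exhausted row is the equation \<open>0 = 0\<close>, that is,
  the white bone. The other entries \<open>v1\<close> of a column are attached afterwards.\<close>

lemma counit_mat:
  assumes "op_arrow x0 x" "set c \<subseteq> cols (Suc k)" "i + length c < w x"
  shows "factored x0 (E' i (mat i c (Suc k) x))"
  using assms
proof (induction c arbitrary: i)
  case Nil
  then show ?case by (simp add: counit_op_unit factored_U_pow factored.base)
next
  case (Cons v c)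
  then obtain q v1 where v: "v = q # v1" "q \<in> carrier R" "set v1 \<subseteq> carrier R" "length v1 = k"
    by (cases v) auto
  have c: "set c \<subseteq> cols (Suc k)" using Cons.prems by simp
  have "E' i (mat i (v # c) (Suc k) x) = act i v1 (E' (Suc i) (shear q i (mat (Suc i) c (Suc k) x)))"
    by (simp add: v act_below G.swap_counit)
  moreover have "factored x0 (E' (Suc i) (shear q i (mat (Suc i) c (Suc k) x)))"
  proof (cases "q = \<zero>")
    case True
    then show ?thesis
      using Cons.IH[of "Suc i"] Cons.prems by (simp add: shear_zero)
  qed (use solve_unit Cons.prems v in auto)
  ultimately show ?case
    using v Cons.prems by (simp add: factored_act)
qed

text \<open>Wire 0 is the first row of the matrix form; any other wire is first brought there by
  swaps.\<close>

lemma factored_counit: "\<lbrakk>factored x0 y; Suc i < w y\<rbrakk> \<Longrightarrow> factored x0 (E' i y)"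
proof (induction i arbitrary: y)
  case 0
  from factored_mat[OF 0(1)] obtain x c m where
    x: "op_arrow x0 x" "w x = Suc (length c)" "w y = Suc m" "set c \<subseteq> cols m" "y = mat 0 c m x" .
  moreover obtain k where "m = Suc k"
    using 0(2) x(3) gr0_conv_Suc by auto
  ultimately show ?case
    by (simp add: counit_mat)
next
  case (Suc i)
  then show ?case
    using Suc.IH[of "T i y"] by (simp add: G.swap_counit factored_steps)
qed

text \<open>Having no inputs, \<open>\<eta>\<^sub>b\<close> at wire 0 slides before every Hopf
  algebra generator, whose position shifts by one.\<close>

lemma factored_unit_0: "factored x0 y \<Longrightarrow> factored x0 (U' 0 y)"
proof (induction rule: factored.induct)
  case (base x)
  then show ?case by (simp add: factored.base op_arrow_steps op_arrow_width)
next
  case (step y t i)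
  then show ?case
    using factored.step[OF step.IH step.hyps(2), of "Suc i"] by (simp add: comm_down)
qed

lemma factored_unit: "\<lbrakk>factored x0 y; i < w y\<rbrakk> \<Longrightarrow> factored x0 (U' i y)"
proof (induction i)
  case (Suc i)
  then have "U' (Suc i) y = T i (U' i y)"
    using G.swap_unit[of i y, symmetric] by (simp add: swap_swap)
  with Suc show ?case by (simp add: factored_steps)
qed (simp add: factored_unit_0)

text \<open>Counit and unit are settled; \<open>comult_op_eq\<close>, \<open>mult_op_eq\<close> and
  \<open>scal_op_eq\<close> express the other generators by them and the Hopf algebra part. The
  opposite zero scalar is a counit followed by a unit.\<close>

theorem factored_haop_op:
  assumes "haop_op t" "factored x0 y" "i + ar t < w y"
  shows "factored x0 (ap t i y)"
  using assms(1)
proof cases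
  case 1
  then show ?thesis
    using assms(2,3) minus_one by (simp add: comult_op_eq factored_steps factored_unit)
next
  case 2
  then show ?thesis using assms(2,3) by (simp add: factored_counit)
next
  case 3
  then show ?thesis
    using assms(2,3) minus_one mult_op_eq[of i y, symmetric] by (simp add: factored_counit factored_shear)
next
  case 4
  then show ?thesis using assms(2,3) by (simp add: factored_unit)
next
  case (5 k)
  show ?thesis
  proof (cases "k = \<zero>")
    case True
    with 5 show ?thesis using assms(2,3) by (simp add: G.scal_zero factored_unit factored_counit)
  next
    case False
    with 5 show ?thesis
      using assms(2,3) scal_op_eq[of k i y, symmetric] by (simp add: factored_counit factored_shear factored_unit)
  qed
next
  case 6
  then show ?thesis using assms(2,3) by (simp add: factored_steps)
qed

end

end

section \<open>Exchanging the colours\<close>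

fun dual_gen :: "'r ha_gen \<Rightarrow> 'r ha_gen" where
  "dual_gen Comult_b = Mult_w"
| "dual_gen Counit_b = Unit_w"
| "dual_gen Mult_w = Comult_b"
| "dual_gen Unit_w = Counit_b"
| "dual_gen (Scal k) = Scal k"

text \<open>Types are preserved: the opposite of \<open>Mult_w\<close> goes from 1 to 2, like
  \<open>Comult_b\<close>. Hence diagrams are recoloured without being reversed.\<close>

definition colour_swap :: "'r ha_gen + 'r ha_gen \<Rightarrow> 'r ha_gen + 'r ha_gen" where
  "colour_swap = case_sum (Inr \<circ> dual_gen) (Inl \<circ> dual_gen)"

lemma colour_swap_simps [simp]:
  "colour_swap (Inl g) = Inr (dual_gen g)" "colour_swap (Inr g) = Inl (dual_gen g)"
  by (simp_all add: colour_swap_def)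

lemma dual_gen_dual_gen [simp]: "dual_gen (dual_gen g) = g"
  by (cases g) auto

lemma colour_swap_colour_swap [simp]: "colour_swap (colour_swap g) = g"
  by (cases g) auto

lemma map_tm_colour_swap_twice [simp]: "map_tm colour_swap (map_tm colour_swap t) = t"
  by (simp add: tm.map_comp comp_def tm.map_ident)

lemma ar_map_tm_colour_swap [simp]:
  "ar (map_tm colour_swap t) = ar t" "coar (map_tm colour_swap t) = coar t"
proof (induction t)
  case (Gen g)
  obtain h where "g = Inl h \<or> g = Inr h" by (cases g) auto
  then show "ar (map_tm colour_swap (Gen g)) = ar (Gen g)" "coar (map_tm colour_swap (Gen g)) = coar (Gen g)"
    by (cases h; auto simp: ar.simps coar.simps)+
qed auto

lemma has_type_map_tm_colour_swap:
  "has_type (IH R) t n m \<Longrightarrow> has_type (IH R) (map_tm colour_swap t) n m"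
proof (induction rule: has_type.induct)
  case (gen g)
  obtain h where "g = Inl h \<or> g = Inr h" by (cases g) auto
  with gen show ?case
    by (cases h)
      (auto intro!: has_type_gen' simp: HA_def HAop_def op_pres_def HA_HAop_def coprod_pres_def IH_def quot_pres_def)
qed (simp only: tm.map, rule has_type.intros; assumption)+

text \<open>The two \<open>hopf\<close> instances trade places and the interaction laws are
  permuted. Only \<open>cup\<close> and \<open>cap\<close> change form: the sign moves to the other
  side, where it cancels against its inverse.\<close>

lemma (in ih_wires) ih_wires_colour_swap: "ih_wires R w (\<lambda>t. ap (map_tm colour_swap t))"
proof (intro ih_wires.intro ih_wires_axioms.intro wires.intro)
  show "domain R" ..
  show "hopf R w (ap (map_tm colour_swap \<Delta>\<^sub>b)) (ap (map_tm colour_swap \<epsilon>\<^sub>b)) (ap (map_tm colour_swap \<mu>\<^sub>w))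
     (ap (map_tm colour_swap \<eta>\<^sub>w)) (\<lambda>k. ap (map_tm colour_swap (scal k))) (ap (map_tm colour_swap Swap))"
    using G.hopf_axioms by simp
  show "hopf R w (ap (map_tm colour_swap \<Delta>\<^sub>w)) (ap (map_tm colour_swap \<epsilon>\<^sub>w)) (ap (map_tm colour_swap \<mu>\<^sub>b))
     (ap (map_tm colour_swap \<eta>\<^sub>b)) (\<lambda>k. ap (map_tm colour_swap (scal_op k))) (ap (map_tm colour_swap Swap))"
    using H.hopf_axioms by simp
  show "w (ap (map_tm colour_swap t) i x) = w x - n + m" if "has_type (IH R) t n m" "i + n < w x" for t n m i x
    using width[OF has_type_map_tm_colour_swap] that by blast
  show "ap (map_tm colour_swap \<Delta>\<^sub>w) i (ap (map_tm colour_swap \<eta>\<^sub>w) i x) =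
      ap (map_tm colour_swap (scal (\<ominus> \<one>))) (Suc i) (ap (map_tm colour_swap \<Delta>\<^sub>b) i (ap (map_tm colour_swap \<eta>\<^sub>b) i x))"
    if "i < w x" for i x
    using that by (simp add: cup scal_scal_op minus_one)
  show "ap (map_tm colour_swap \<epsilon>\<^sub>w) i (ap (map_tm colour_swap \<mu>\<^sub>w) i x) =
      ap (map_tm colour_swap \<epsilon>\<^sub>b) i (ap (map_tm colour_swap \<mu>\<^sub>b) i (ap (map_tm colour_swap (scal (\<ominus> \<one>))) (Suc i) x))"
    if "Suc (Suc i) < w x" for i x
    using that by (simp add: cap scal_op_scal minus_one)
qed (simp_all add: comm swap_swap yang_baxter scal_scal_op scal_op_scal
    frobenius_w1 frobenius_w2 frobenius_b1 frobenius_b2 special_w special_b)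

section \<open>Arrows as states\<close>

declare prop_eq.trans [trans]

definition pad :: "nat \<Rightarrow> 'g tm \<Rightarrow> nat \<Rightarrow> 'g tm" where
  "pad i t j = idn i \<boxplus> t \<boxplus> idn j"

lemma has_type_pad: "has_type P t a b \<Longrightarrow> n = i + a + j \<Longrightarrow> m = i + b + j \<Longrightarrow> has_type P (pad i t j) n m"
  unfolding pad_def by (auto intro: has_type.par has_type_idn)

lemma has_type_padD: "has_type P (pad i t j) n m \<Longrightarrow> \<exists>a b. has_type P t a b"
  unfolding pad_def by (auto elim!: has_type_ParE)

lemma idn_refl: "prop_eq P (idn n) (idn n)"
  by (rule prop_eq.refl[OF has_type_idn])

lemma idn_add: "prop_eq P (idn (a + b)) (idn a \<boxplus> idn b)"
proof (induction a)
  case 0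
  show ?case by (simp add: prop_eq.sym prop_eq.par_unit_left[OF has_type_idn])
next
  case (Suc a)
  have "prop_eq P (Id1 \<boxplus> idn (a + b)) (Id1 \<boxplus> (idn a \<boxplus> idn b))"
    by (intro prop_eq.cong_par Suc prop_eq.refl[OF has_type.id1])
  also have "prop_eq P \<dots> (Id1 \<boxplus> idn a \<boxplus> idn b)"
    by (rule prop_eq.sym[OF prop_eq.par_assoc[OF has_type.id1 has_type_idn has_type_idn]])
  finally show ?case by simp
qed

lemma pad_cong: "prop_eq P t u \<Longrightarrow> prop_eq P (pad i t j) (pad i u j)"
  unfolding pad_def by (intro prop_eq.cong_par idn_refl)

lemma pad_seq:
  assumes "has_type P t a b" "has_type P u b c"
  shows "prop_eq P (pad i (t ;; u) j) (pad i t j ;; pad i u j)"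
proof -
  have id: "prop_eq P (idn k) (idn k ;; idn k)" for k
    by (rule prop_eq.sym[OF prop_eq.seq_id_left[OF has_type_idn]])
  have "has_type P (t ;; u) a c" using assms by (rule has_type.seq)
  then have "prop_eq P (idn i \<boxplus> (t ;; u) \<boxplus> idn j) ((idn i ;; idn i) \<boxplus> (t ;; u) \<boxplus> (idn j ;; idn j))"
    by (intro prop_eq.cong_par id prop_eq.refl)
  also have "prop_eq P \<dots> (((idn i \<boxplus> t) ;; (idn i \<boxplus> u)) \<boxplus> (idn j ;; idn j))"
    by (intro prop_eq.cong_par prop_eq.interchange[OF has_type_idn has_type_idn assms] prop_eq.sym[OF id]
        prop_eq.trans[OF prop_eq.sym[OF id] id])
  also have "prop_eq P \<dots> ((idn i \<boxplus> t \<boxplus> idn j) ;; (idn i \<boxplus> u \<boxplus> idn j))"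
    by (rule prop_eq.interchange[OF has_type.par[OF has_type_idn assms(1)] has_type.par[OF has_type_idn assms(2)]
        has_type_idn has_type_idn])
  finally show ?thesis unfolding pad_def .
qed

lemma pad_pad:
  assumes "has_type P t a b"
  shows "prop_eq P (pad i (pad k t l) j) (pad (i + k) t (l + j))"
proof -
  have t: "prop_eq P t t" using assms by (rule prop_eq.refl)
  have kt: "has_type P (idn k \<boxplus> t) (k + a) (k + b)" by (intro has_type.par has_type_idn assms)
  have ikt: "has_type P (idn i \<boxplus> (idn k \<boxplus> t)) (i + (k + a)) (i + (k + b))" by (intro has_type.par has_type_idn kt)
  have "prop_eq P (idn i \<boxplus> (idn k \<boxplus> t \<boxplus> idn l) \<boxplus> idn j) (idn i \<boxplus> (idn k \<boxplus> t) \<boxplus> idn l \<boxplus> idn j)"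
    by (intro prop_eq.cong_par idn_refl prop_eq.sym[OF prop_eq.par_assoc[OF has_type_idn kt has_type_idn]])
  also have "prop_eq P \<dots> (idn i \<boxplus> (idn k \<boxplus> t) \<boxplus> (idn l \<boxplus> idn j))"
    by (rule prop_eq.par_assoc[OF ikt has_type_idn has_type_idn])
  also have "prop_eq P \<dots> (idn i \<boxplus> idn k \<boxplus> t \<boxplus> idn (l + j))"
    by (intro prop_eq.cong_par prop_eq.sym[OF prop_eq.par_assoc[OF has_type_idn has_type_idn assms]] prop_eq.sym[OF idn_add])
  also have "prop_eq P \<dots> (idn (i + k) \<boxplus> t \<boxplus> idn (l + j))"
    by (intro prop_eq.cong_par prop_eq.sym[OF idn_add] idn_refl t)
  finally show ?thesis unfolding pad_def .
qed

lemma pad_id: "prop_eq P (pad i (idn k) j) (idn (i + k + j))"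
  unfolding pad_def by (meson idn_add idn_refl prop_eq.cong_par prop_eq.sym prop_eq.trans)

lemma pad_0:
  assumes "has_type P t a b"
  shows "prop_eq P (pad 0 t 0) t"
proof -
  have "prop_eq P (pad 0 t 0) (Id0 \<boxplus> t)"
    using prop_eq.par_unit_right[OF has_type.par[OF has_type.id0 assms]] by (simp add: pad_def)
  also have "prop_eq P \<dots> t" using assms by (rule prop_eq.par_unit_left)
  finally show ?thesis .
qed

lemma par_split:
  assumes t: "has_type P t a b" and u: "has_type P u c d"
  shows "prop_eq P (t \<boxplus> u) (pad 0 t c ;; pad b u 0)" "prop_eq P (t \<boxplus> u) (pad a u 0 ;; pad 0 t d)"
proof -
  have l: "prop_eq P (t \<boxplus> idn k) (pad 0 t k)" for k
    unfolding pad_def idn.simps by (intro prop_eq.cong_par idn_refl prop_eq.sym[OF prop_eq.par_unit_left[OF t]])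
  have r: "prop_eq P (idn k \<boxplus> u) (pad k u 0)" for k
    unfolding pad_def idn.simps by (rule prop_eq.sym[OF prop_eq.par_unit_right[OF has_type.par[OF has_type_idn u]]])
  have "prop_eq P (t \<boxplus> u) ((t ;; idn b) \<boxplus> (idn c ;; u))"
    by (intro prop_eq.cong_par prop_eq.sym[OF prop_eq.seq_id_right[OF t]] prop_eq.sym[OF prop_eq.seq_id_left[OF u]])
  also have "prop_eq P \<dots> ((t \<boxplus> idn c) ;; (idn b \<boxplus> u))"
    by (rule prop_eq.interchange[OF t has_type_idn has_type_idn u])
  also have "prop_eq P \<dots> (pad 0 t c ;; pad b u 0)"
    by (rule prop_eq.cong_seq[OF l r has_type.par[OF t has_type_idn] has_type.par[OF has_type_idn u]])
  finally show "prop_eq P (t \<boxplus> u) (pad 0 t c ;; pad b u 0)" .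
  have "prop_eq P (t \<boxplus> u) ((idn a ;; t) \<boxplus> (u ;; idn d))"
    by (intro prop_eq.cong_par prop_eq.sym[OF prop_eq.seq_id_left[OF t]] prop_eq.sym[OF prop_eq.seq_id_right[OF u]])
  also have "prop_eq P \<dots> ((idn a \<boxplus> u) ;; (t \<boxplus> idn d))"
    by (rule prop_eq.interchange[OF has_type_idn t u has_type_idn])
  also have "prop_eq P \<dots> (pad a u 0 ;; pad 0 t d)"
    by (rule prop_eq.cong_seq[OF r l has_type.par[OF has_type_idn u] has_type.par[OF t has_type_idn]])
  finally show "prop_eq P (t \<boxplus> u) (pad a u 0 ;; pad 0 t d)" .
qed

text \<open>Interchange allows either factor to be attached first; the position of \<open>u\<close>
  depends on whether \<open>t\<close> has already changed the number of wires.\<close>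

lemma pad_par:
  assumes t: "has_type P t a b" and u: "has_type P u c d"
  shows "prop_eq P (pad i (t \<boxplus> u) j) (pad i t (c + j) ;; pad (i + b) u j)"
    "prop_eq P (pad i (t \<boxplus> u) j) (pad (i + a) u j ;; pad i t (d + j))"
proof -
  have t': "has_type P (pad 0 t k) (a + k) (b + k)" for k by (intro has_type_pad[OF t]) auto
  have u': "has_type P (pad k u 0) (k + c) (k + d)" for k by (intro has_type_pad[OF u]) auto
  have "prop_eq P (pad i (t \<boxplus> u) j) (pad i (pad 0 t c ;; pad b u 0) j)"
    by (intro pad_cong par_split(1)[OF t u])
  also have "prop_eq P \<dots> (pad i (pad 0 t c) j ;; pad i (pad b u 0) j)"
    by (rule pad_seq[OF t' u'])
  also have "prop_eq P \<dots> (pad i t (c + j) ;; pad (i + b) u j)"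
    using prop_eq.cong_seq[OF pad_pad[OF t, of i 0 c j] pad_pad[OF u, of i b 0 j]
        has_type_pad[OF t' HOL.refl HOL.refl] has_type_pad[OF u']] by simp
  finally show "prop_eq P (pad i (t \<boxplus> u) j) (pad i t (c + j) ;; pad (i + b) u j)" .
  have "prop_eq P (pad i (t \<boxplus> u) j) (pad i (pad a u 0 ;; pad 0 t d) j)"
    by (intro pad_cong par_split(2)[OF t u])
  also have "prop_eq P \<dots> (pad i (pad a u 0) j ;; pad i (pad 0 t d) j)"
    by (rule pad_seq[OF u' t'])
  also have "prop_eq P \<dots> (pad (i + a) u j ;; pad i t (d + j))"
    using prop_eq.cong_seq[OF pad_pad[OF u, of i a 0 j] pad_pad[OF t, of i 0 d j]
        has_type_pad[OF u' HOL.refl HOL.refl] has_type_pad[OF t']] by simp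
  finally show "prop_eq P (pad i (t \<boxplus> u) j) (pad (i + a) u j ;; pad i t (d + j))" .
qed

lemma map_tm_pad: "map_tm f (pad i t j) = pad i (map_tm f t) j"
  by (simp add: pad_def map_tm_idn)

section \<open>States: arrows out of a fixed object\<close>

lemma has_type_IH_ar: "has_type (IH R) t n m \<Longrightarrow> n = ar t \<and> m = coar t"
proof (induction rule: has_type.induct)
  case (gen g)
  then show ?case
    by (cases g) (auto simp: ar.simps coar.simps HA_def HAop_def op_pres_def HA_HAop_def coprod_pres_def IH_def quot_pres_def)
qed auto

text \<open>The shift by one reserves 0 for sets that are not arrows out of \<open>n\<close>, in
  particular for the error state \<open>{}\<close>.\<close>

definition width :: "('r, 'z) ring_scheme \<Rightarrow> nat \<Rightarrow> ('r ha_gen + 'r ha_gen) tm set \<Rightarrow> nat" where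
  "width R n x = (if \<exists>u m. has_type (IH R) u n m \<and> x = arrow_of (IH R) u
     then Suc (THE m. \<exists>u. has_type (IH R) u n m \<and> x = arrow_of (IH R) u) else 0)"

definition ap :: "('r, 'z) ring_scheme \<Rightarrow> nat \<Rightarrow> ('r ha_gen + 'r ha_gen) tm \<Rightarrow> nat \<Rightarrow>
    ('r ha_gen + 'r ha_gen) tm set \<Rightarrow> ('r ha_gen + 'r ha_gen) tm set" where
  "ap R n t i x = (if i + ar t < width R n x
     then arrow_comp (IH R) x (arrow_of (IH R) (pad i t (width R n x - Suc (i + ar t)))) else {})"

lemma arrow_of_untyped: "\<nexists>n m. has_type P t n m \<Longrightarrow> arrow_of P t = {}"
  unfolding arrow_of_def using prop_eq_has_type by blast

lemma arrow_ofI: "prop_eq P t u \<Longrightarrow> arrow_of P t = arrow_of P u"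
  unfolding arrow_of_def using prop_eq.sym prop_eq.trans by blast

context
  fixes R :: "('r, 'z) ring_scheme" (structure) and n :: nat
begin

lemma width_arrow_of:
  assumes "has_type (IH R) u n m"
  shows "width R n (arrow_of (IH R) u) = Suc m"
proof -
  have "m' = m" if "has_type (IH R) u' n m'" "arrow_of (IH R) u = arrow_of (IH R) u'" for u' m'
  proof -
    from that(2) have "prop_eq (IH R) u u'" using arrow_of_eq_iff[OF assms] by blast
    then obtain a b where "has_type (IH R) u a b" "has_type (IH R) u' a b" using prop_eq_has_type by blast
    then show ?thesis using has_type_unique that(1) assms by blast
  qed
  then have "(THE m. \<exists>u'. has_type (IH R) u' n m \<and> arrow_of (IH R) u = arrow_of (IH R) u') = m"
    using assms by (intro the_equality) blast+
  moreover have "\<exists>u' m. has_type (IH R) u' n m \<and> arrow_of (IH R) u = arrow_of (IH R) u'"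
    using assms by blast
  ultimately show ?thesis unfolding width_def by simp
qed

lemma width_posE:
  assumes "k < width R n x"
  obtains u m where "has_type (IH R) u n m" "x = arrow_of (IH R) u" "width R n x = Suc m"
proof -
  have "\<exists>u m. has_type (IH R) u n m \<and> x = arrow_of (IH R) u"
  proof (rule ccontr)
    assume "\<not> ?thesis"
    then have "width R n x = 0" unfolding width_def by (rule if_not_P)
    with assms show False by simp
  qed
  then obtain u m where "has_type (IH R) u n m" "x = arrow_of (IH R) u" by blast
  with that width_arrow_of show thesis by blast
qed

lemma width_empty [simp]: "width R n {} = 0"
proof (rule ccontr)
  assume "width R n {} \<noteq> 0"
  then obtain u m where u: "has_type (IH R) u n m" "{} = arrow_of (IH R) u"
    using width_posE[of 0 "{}"] by blast
  then have "u \<in> arrow_of (IH R) u"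
    unfolding arrow_of_def using prop_eq.refl by blast
  with u(2) show False by blast
qed

lemma ap_empty [simp]: "ap R n t i {} = {}"
  by (simp add: ap_def)

lemma ap_none: "width R n x \<le> i + ar t \<Longrightarrow> ap R n t i x = {}"
  by (simp add: ap_def)

lemma ap_untyped:
  assumes "\<nexists>a b. has_type (IH R) t a b"
  shows "ap R n t i x = {}"
proof -
  have "arrow_of (IH R) (pad i t j) = {}" for j
    using assms has_type_padD by (intro arrow_of_untyped) blast
  then show ?thesis by (simp add: ap_def arrow_comp_def)
qed

lemma ap_arrow_of:
  assumes "has_type (IH R) u n m" "has_type (IH R) t a b" "i + a \<le> m"
  shows "ap R n t i (arrow_of (IH R) u) = arrow_of (IH R) (u ;; pad i t (m - (i + a)))"
    "has_type (IH R) (u ;; pad i t (m - (i + a))) n (m - a + b)"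
proof -
  have p: "has_type (IH R) (pad i t (m - (i + a))) m (m - a + b)"
    using assms by (intro has_type_pad[OF assms(2)]) auto
  show "ap R n t i (arrow_of (IH R) u) = arrow_of (IH R) (u ;; pad i t (m - (i + a)))"
    using assms has_type_IH_ar[OF assms(2)] arrow_comp_arrow_of[OF assms(1) p]
    by (simp add: ap_def width_arrow_of)
  show "has_type (IH R) (u ;; pad i t (m - (i + a))) n (m - a + b)"
    using assms(1) p by (rule has_type.seq)
qed

lemma width_ap:
  assumes "has_type (IH R) t a b" "i + a < width R n x"
  shows "width R n (ap R n t i x) = width R n x - a + b"
proof -
  from assms(2) obtain u m where u: "has_type (IH R) u n m" "x = arrow_of (IH R) u" "width R n x = Suc m"
    by (rule width_posE)
  then show ?thesis
    using ap_arrow_of[OF u(1) assms(1), of i] width_arrow_of assms(2) by simp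
qed

lemma ap_prop_eq:
  assumes "prop_eq (IH R) t u"
  shows "ap R n t i x = ap R n u i x"
proof -
  obtain a b where ab: "has_type (IH R) t a b" "has_type (IH R) u a b"
    using prop_eq_has_type[OF assms] by blast
  then have "ar t = ar u" using has_type_IH_ar by metis
  then show ?thesis
    using arrow_ofI[OF pad_cong[OF assms]] by (simp add: ap_def)
qed

lemma ap_seq:
  assumes "has_type (IH R) t a b" "has_type (IH R) u b c"
  shows "ap R n (t ;; u) i x = ap R n u i (ap R n t i x)"
proof (cases "i + a < width R n x")
  case True
  then obtain v m where v: "has_type (IH R) v n m" "x = arrow_of (IH R) v" "width R n x = Suc m"
    by (rule width_posE)
  have tu: "has_type (IH R) (t ;; u) a c" using assms by (rule has_type.seq)
  have im: "i + a \<le> m" "i + b \<le> m - a + b" "m - a + b - (i + b) = m - (i + a)" using True v by auto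
  let ?j = "m - (i + a)"
  have p: "has_type (IH R) (pad i t ?j) m (m - a + b)" "has_type (IH R) (pad i u ?j) (m - a + b) (m - a + c)"
    using im by (auto intro: has_type_pad[OF assms(1)] has_type_pad[OF assms(2)])
  have "prop_eq (IH R) (v ;; pad i (t ;; u) ?j) (v ;; (pad i t ?j ;; pad i u ?j))"
    by (rule prop_eq.cong_seq[OF prop_eq.refl[OF v(1)] pad_seq[OF assms] v(1) has_type_pad[OF tu]]) (use im in auto)
  also have "prop_eq (IH R) \<dots> (v ;; pad i t ?j ;; pad i u ?j)"
    by (rule prop_eq.sym[OF prop_eq.seq_assoc[OF v(1) p]])
  finally show ?thesis
    using ap_arrow_of[OF v(1) tu im(1)] ap_arrow_of[OF v(1) assms(1) im(1)]
      ap_arrow_of(1)[OF ap_arrow_of(2)[OF v(1) assms(1) im(1)] assms(2) im(2)] im(3) v(2)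
    by (simp add: arrow_ofI)
next
  case False
  then show ?thesis
    using has_type_IH_ar[OF assms(1)] by (simp add: ap_none)
qed

lemma ap_id:
  assumes "i + k < width R n x"
  shows "ap R n (idn k) i x = x"
proof -
  from assms obtain v m where v: "has_type (IH R) v n m" "x = arrow_of (IH R) v" "width R n x = Suc m"
    by (rule width_posE)
  then have im: "i + k \<le> m" using assms by simp
  have "prop_eq (IH R) (v ;; pad i (idn k) (m - (i + k))) (v ;; idn m)"
    using im pad_id[of "IH R" i k "m - (i + k)"]
    by (intro prop_eq.cong_seq[OF prop_eq.refl[OF v(1)] _ v(1) has_type_pad[OF has_type_idn]]) auto
  also have "prop_eq (IH R) \<dots> v" by (rule prop_eq.seq_id_right[OF v(1)])
  finally show ?thesis
    using ap_arrow_of(1)[OF v(1) has_type_idn im] v(2) by (simp add: arrow_ofI)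
qed

lemma ap_par:
  assumes "has_type (IH R) t a b" "has_type (IH R) u c d"
  shows "ap R n (t \<boxplus> u) i x = ap R n t i (ap R n u (i + a) x)"
    and "i + a + c < width R n x \<Longrightarrow> ap R n (t \<boxplus> u) i x = ap R n u (i + b) (ap R n t i x)"
proof -
  have *: "ap R n (t \<boxplus> u) i x = ap R n t i (ap R n u (i + a) x) \<and>
    ap R n (t \<boxplus> u) i x = ap R n u (i + b) (ap R n t i x)" if "i + a + c < width R n x"
  proof -
    from that obtain v m where v: "has_type (IH R) v n m" "x = arrow_of (IH R) v" "width R n x = Suc m"
      by (rule width_posE)
    have "i + a + c \<le> m" using that v(3) by simp
    then obtain j where j: "m = i + a + c + j" using le_Suc_ex by blast
    have tu: "has_type (IH R) (t \<boxplus> u) (a + c) (b + d)" using assms by (rule has_type.par)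
    have p1: "has_type (IH R) (pad i t (c + j)) m (i + b + c + j)" "has_type (IH R) (pad (i + b) u j) (i + b + c + j) (i + b + d + j)"
      and p2: "has_type (IH R) (pad (i + a) u j) m (i + a + d + j)" "has_type (IH R) (pad i t (d + j)) (i + a + d + j) (i + b + d + j)"
      and p: "has_type (IH R) (pad i (t \<boxplus> u) j) m (i + b + d + j)"
      using j by (auto intro: has_type_pad[OF assms(1)] has_type_pad[OF assms(2)] has_type_pad[OF tu])
    have *: "arrow_of (IH R) (v ;; pad i (t \<boxplus> u) j) = arrow_of (IH R) (v ;; pad i t (c + j) ;; pad (i + b) u j)"
      by (intro arrow_ofI prop_eq.trans[OF prop_eq.cong_seq[OF prop_eq.refl[OF v(1)] pad_par(1)[OF assms] v(1) p]]
          prop_eq.sym[OF prop_eq.seq_assoc[OF v(1) p1]])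
    have **: "arrow_of (IH R) (v ;; pad i (t \<boxplus> u) j) = arrow_of (IH R) (v ;; pad (i + a) u j ;; pad i t (d + j))"
      by (intro arrow_ofI prop_eq.trans[OF prop_eq.cong_seq[OF prop_eq.refl[OF v(1)] pad_par(2)[OF assms] v(1) p]]
          prop_eq.sym[OF prop_eq.seq_assoc[OF v(1) p2]])
    have 0: "ap R n (t \<boxplus> u) i x = arrow_of (IH R) (v ;; pad i (t \<boxplus> u) j)"
      using ap_arrow_of(1)[OF v(1) tu, of i] j v(2) by simp
    have 1: "ap R n u (i + b) (ap R n t i x) = arrow_of (IH R) (v ;; pad i t (c + j) ;; pad (i + b) u j)"
      using ap_arrow_of[OF v(1) assms(1), of i] ap_arrow_of(1)[OF has_type.seq[OF v(1) p1(1)] assms(2), of "i + b"] j v(2)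
      by (simp add: add.assoc)
    have 2: "ap R n t i (ap R n u (i + a) x) = arrow_of (IH R) (v ;; pad (i + a) u j ;; pad i t (d + j))"
      using ap_arrow_of[OF v(1) assms(2), of "i + a"] ap_arrow_of(1)[OF has_type.seq[OF v(1) p2(1)] assms(1), of i] j v(2)
      by (simp add: add.assoc)
    show ?thesis using 0 1 2 * ** by simp
  qed
  then show "i + a + c < width R n x \<Longrightarrow> ap R n (t \<boxplus> u) i x = ap R n u (i + b) (ap R n t i x)" by blast
  show "ap R n (t \<boxplus> u) i x = ap R n t i (ap R n u (i + a) x)"
  proof (cases "i + a + c < width R n x")
    case False
    then show ?thesis
      using has_type_IH_ar[OF assms(1)] has_type_IH_ar[OF assms(2)] by (simp add: ap_none)
  qed (use * in blast)
qed

text \<open>The \<open>d\<close> wires between \<open>s\<close> and \<open>t\<close> are added to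
  \<open>s\<close> as identities; then the two orders of \<open>ap_par\<close> can be compared. If
  \<open>t\<close> or \<open>s\<close> does not fit, both sides are the error state.\<close>

lemma ap_comm:
  assumes "i + coar s \<le> j"
  shows "ap R n t j (ap R n s i x) = ap R n s i (ap R n t (j - coar s + ar s) x)"
proof (cases "(\<exists>a b. has_type (IH R) s a b) \<and> (\<exists>a b. has_type (IH R) t a b)")
  case False
  then show ?thesis by (auto simp: ap_untyped)
next
  case True
  then have s: "has_type (IH R) s (ar s) (coar s)" and t: "has_type (IH R) t (ar t) (coar t)"
    using has_type_IH_ar by metis+
  obtain d where d: "j = i + coar s + d" using assms le_Suc_ex by blast
  show ?thesis
  proof (cases "i + ar s + d + ar t < width R n x")
    case True
    have sd: "has_type (IH R) (s \<boxplus> idn d) (ar s + d) (coar s + d)"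
      by (intro has_type.par s has_type_idn)
    have l: "ap R n (s \<boxplus> idn d) i y = ap R n s i y" if "i + ar s + d < width R n y" for y
      using ap_par(1)[OF s has_type_idn, of d i y] ap_id[of "i + ar s" d y] that by simp
    have "ap R n t (i + (coar s + d)) (ap R n (s \<boxplus> idn d) i x) = ap R n (s \<boxplus> idn d) i (ap R n t (i + (ar s + d)) x)"
      using ap_par[OF sd t, of i x] True by (simp add: add.assoc)
    moreover have "i + ar s + d < width R n (ap R n t (i + (ar s + d)) x)"
      using width_ap[OF t, of "i + (ar s + d)" x] True by simp
    ultimately show ?thesis
      using l True d by (simp add: ac_simps)
  next
    case False
    have "ap R n t j (ap R n s i x) = {}"
    proof (cases "i + ar s < width R n x")
      case True
      then show ?thesis
        using width_ap[OF s True] False d by (intro ap_none) simp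
    qed (simp add: ap_none)
    moreover have "ap R n t (j - coar s + ar s) x = {}"
      using False d by (intro ap_none) simp
    ultimately show ?thesis by simp
  qed
qed

section \<open>Symmetries as sequences of adjacent swaps, and their naturality\<close>

fun rotate_wire :: "nat \<Rightarrow> nat \<Rightarrow> ('r ha_gen + 'r ha_gen) tm set \<Rightarrow> ('r ha_gen + 'r ha_gen) tm set" where
  "rotate_wire 0 i x = x"
| "rotate_wire (Suc q) i x = rotate_wire q (Suc i) (ap R n Swap i x)"

lemma ap_Id1: "Suc i < width R n x \<Longrightarrow> ap R n Id1 i x = x"
  using ap_id[of i 1 x] ap_par(1)[OF has_type.id1 has_type.id0, of i x] ap_id[of "Suc i" 0 x] by simp

lemma ap_swap1: "i + Suc q < width R n x \<Longrightarrow> ap R n (swap1 q) i x = rotate_wire q i x"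
proof (induction q arbitrary: i x)
  case 0
  then show ?case by (simp add: ap_Id1)
next
  case (Suc q)
  have a: "has_type (IH R) (Swap \<boxplus> idn q) (2 + q) (2 + q)"
    by (intro has_type.intros has_type_idn)
  have b: "has_type (IH R) (Id1 \<boxplus> swap1 q) (2 + q) (2 + q)"
    using has_type.par[OF has_type.id1 has_type_swap1, of "IH R" q] by simp
  let ?y = "ap R n Swap i x"
  have w: "width R n ?y = width R n x"
    using width_ap[OF has_type.swap, of i x] Suc.prems by simp
  have "ap R n (swap1 (Suc q)) i x = ap R n (Id1 \<boxplus> swap1 q) i (ap R n (Swap \<boxplus> idn q) i x)"
    using ap_seq[OF a b] by simp
  also have "ap R n (Swap \<boxplus> idn q) i x = ?y"
    using ap_par(1)[OF has_type.swap has_type_idn, of q i x] ap_id[of "i + 2" q x] Suc.prems by simp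
  also have "ap R n (Id1 \<boxplus> swap1 q) i ?y = ap R n Id1 i (rotate_wire q (Suc i) ?y)"
    using ap_par(1)[OF has_type.id1 has_type_swap1, of q i ?y] Suc.IH[of "Suc i" ?y] Suc.prems w by simp
  also have "\<dots> = rotate_wire q (Suc i) ?y"
  proof (rule ap_Id1)
    show "Suc i < width R n (rotate_wire q (Suc i) ?y)"
      using Suc.IH[of "Suc i" ?y] Suc.prems w width_ap[OF has_type_swap1, of "Suc i" q ?y] by simp
  qed
  finally show ?case by simp
qed

lemma ap_swaps_1:
  assumes "i + Suc q < width R n x"
  shows "ap R n (swaps 1 q) i x = rotate_wire q i x"
proof -
  have a: "has_type (IH R) (Id1 \<boxplus> idn q) (Suc q) (Suc q)"
    using has_type_idn[of "IH R" "Suc q"] by simp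
  have b: "has_type (IH R) (swap1 q \<boxplus> Id0) (Suc q) (Suc q)"
    using has_type.par[OF has_type_swap1 has_type.id0, of "IH R" q] by simp
  have "ap R n (swaps 1 q) i x = ap R n (swap1 q \<boxplus> Id0) i x"
    using ap_seq[OF a b] ap_id[of i "Suc q" x] assms by simp
  also have "\<dots> = ap R n (swap1 q) i x"
    using ap_par(1)[OF has_type_swap1 has_type.id0, of q i x] ap_id[of "i + Suc q" 0 x] assms by simp
  finally show ?thesis using ap_swap1 assms by simp
qed

text \<open>\<open>swap_natural\<close> for one wire against \<open>t\<close>. On generators it
  yields the swap laws of \<open>hopf\<close>, and on \<open>Swap\<close> the Yang-Baxter
  equation.\<close>

lemma rotate_wire_natural:
  assumes "has_type (IH R) t a b" "Suc (i + a) < width R n x"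
  shows "rotate_wire b i (ap R n t (Suc i) x) = ap R n t i (rotate_wire a i x)"
proof -
  have 1: "has_type (IH R) (Id1 \<boxplus> t) (1 + a) (1 + b)" and 2: "has_type (IH R) (t \<boxplus> Id1) (a + 1) (b + 1)"
    by (intro has_type.par has_type.id1 assms)+
  have w: "width R n (ap R n t (Suc i) x) = width R n x - a + b"
    using width_ap[OF assms(1), of "Suc i" x] assms(2) by simp
  have "ap R n (swaps 1 b) i (ap R n (Id1 \<boxplus> t) i x) = ap R n ((Id1 \<boxplus> t) ;; swaps 1 b) i x"
    by (rule ap_seq[OF 1 has_type_swaps, symmetric])
  also have "\<dots> = ap R n (swaps 1 a ;; (t \<boxplus> Id1)) i x"
    by (rule ap_prop_eq[OF prop_eq.swap_natural[OF has_type.id1 assms(1)]])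
  also have "\<dots> = ap R n (t \<boxplus> Id1) i (ap R n (swaps 1 a) i x)"
    by (rule ap_seq[OF has_type_swaps 2])
  finally have "ap R n (swaps 1 b) i (ap R n (Id1 \<boxplus> t) i x) = ap R n (t \<boxplus> Id1) i (ap R n (swaps 1 a) i x)" .
  moreover have "ap R n (Id1 \<boxplus> t) i x = ap R n t (Suc i) x"
    using ap_par(1)[OF has_type.id1 assms(1), of i x] ap_Id1[of i "ap R n t (Suc i) x"] assms(2) w by simp
  moreover have "ap R n (t \<boxplus> Id1) i y = ap R n t i y" if "Suc (i + a) < width R n y" for y
    using ap_par(1)[OF assms(1) has_type.id1, of i y] ap_Id1[of "i + a" y] that by simp
  moreover have "width R n (rotate_wire a i x) = width R n x"
    using ap_swap1[of i a x] width_ap[OF has_type_swap1, of i a x] assms(2) by simp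
  ultimately show ?thesis
    using ap_swaps_1[of i a x] ap_swaps_1[of i b "ap R n t (Suc i) x"] assms(2) w by simp
qed

lemma rotate_wire_empty [simp]: "rotate_wire a i {} = {}"
  by (induction a arbitrary: i) auto

lemma rotate_wire_none: "\<lbrakk>0 < a; width R n x \<le> Suc (i + a)\<rbrakk> \<Longrightarrow> rotate_wire a i x = {}"
proof (induction a arbitrary: i x)
  case (Suc a)
  show ?case
  proof (cases "i + 2 < width R n x")
    case True
    then show ?thesis
      using Suc.IH[of "ap R n Swap i x" "Suc i"] Suc.prems width_ap[OF has_type.swap True] by simp
  qed (simp add: ap_none)
qed simp

text \<open>On states that are too narrow both sides are \<open>{}\<close>. This uses
  \<open>0 < a\<close>, since \<open>rotate_wire 0\<close> is the identity and signals no
  error.\<close>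

lemma rotate_wire_natural':
  assumes "has_type (IH R) t a b" "0 < a"
  shows "rotate_wire b i (ap R n t (Suc i) x) = ap R n t i (rotate_wire a i x)"
proof (cases "Suc (i + a) < width R n x")
  case False
  then show ?thesis
    using has_type_IH_ar[OF assms(1)] assms(2) by (simp add: ap_none rotate_wire_none)
qed (rule rotate_wire_natural[OF assms(1)])

lemma wires_ap: "wires R (width R n) (ap R n)"
proof
  let ?T = "ap R n Swap"
  show "width R n (ap R n t i x) = width R n x - a + b" if "has_type (IH R) t a b" "i + a < width R n x" for t a b i x
    using width_ap that .
  show "ap R n t j (ap R n s i x) = ap R n s i (ap R n t (j - coar s + ar s) x)" if "i + coar s \<le> j" for i s j t x
    using ap_comm that .
  have [simp]: "width R n (?T i x) = width R n x" if "Suc (Suc i) < width R n x" for i x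
    using width_ap[OF has_type.swap, of i x] that by simp
  show "?T i (?T i x) = x" if "Suc (Suc i) < width R n x" for i x
    using ap_prop_eq[OF prop_eq.swap_swap[of "IH R" 1 1]] ap_seq[OF has_type_swaps has_type_swaps, of 1 1 i x]
      ap_swaps_1[of i 1 x] ap_swaps_1[of i 1 "?T i x"] ap_id[of i 2 x] that by (simp add: numeral_2_eq_2)
  show "?T (Suc i) (?T i (?T (Suc i) x)) = ?T i (?T (Suc i) (?T i x))" for i x
  proof (cases "Suc (i + 2) < width R n x")
    case True
    then show ?thesis using rotate_wire_natural[OF has_type.swap] by (simp add: numeral_2_eq_2)
  next
    case False
    then have "?T (Suc i) x = {}" "?T (Suc i) (?T i x) = {}"
      using ap_none[of x "Suc i" Swap] ap_none[of "?T i x" "Suc i" Swap] ap_none[of x i Swap]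
      by (cases "Suc (Suc i) < width R n x"; simp)+
    then show ?thesis by simp
  qed
qed

end

context
  fixes R :: "('r, 'z) ring_scheme" (structure) and n :: nat
begin

text \<open>The next three rules move identity wires outwards until they are absorbed, whatever the width.\<close>

lemma ap_Id1_inner: "Suc j \<le> i + ar t \<Longrightarrow> ap R n t i (ap R n Id1 j x) = ap R n t i x"
  by (cases "Suc j < width R n x") (simp_all add: ap_Id1 ap_none)

lemma ap_Id1_outer:
  assumes "Suc j \<le> i + coar t"
  shows "ap R n Id1 j (ap R n t i x) = ap R n t i x"
proof (cases "has_type (IH R) t (ar t) (coar t) \<and> i + ar t < width R n x")
  case True
  then show ?thesis
    using width_ap[of R t "ar t" "coar t" i n x] assms True by (intro ap_Id1) auto
next
  case False
  then have "ap R n t i x = {}"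
    using ap_none[of R n x i t] ap_untyped[of R t n i x] has_type_IH_ar by (metis not_le)
  then show ?thesis by simp
qed

lemma ap_Id1_outwards:
  "i + ar t \<le> j \<Longrightarrow> ap R n t i (ap R n Id1 j x) = ap R n Id1 (j - ar t + coar t) (ap R n t i x)"
  using ap_comm[of i t "j - ar t + coar t" R n Id1 x] by simp

end

section \<open>The presented PROP satisfies the wire laws\<close>

definition typed :: "('r, 'z) ring_scheme \<Rightarrow> ('r ha_gen + 'r ha_gen) tm \<Rightarrow> bool" where
  "typed R t \<longleftrightarrow> has_type (IH R) t (ar t) (coar t)"

lemma typedD: "typed R t \<Longrightarrow> has_type (IH R) t (ar t) (coar t)"
  by (simp add: typed_def)

lemma typed_seq: "\<lbrakk>typed R t; typed R u; coar t = ar u\<rbrakk> \<Longrightarrow> typed R (t ;; u)"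
  unfolding typed_def by (auto intro: has_type.seq)

lemma typed_par: "\<lbrakk>typed R t; typed R u\<rbrakk> \<Longrightarrow> typed R (t \<boxplus> u)"
  unfolding typed_def by (auto intro: has_type.par)

lemma typed_gen:
  fixes R :: "('r, 'z) ring_scheme" (structure)
  shows
  "typed R \<Delta>\<^sub>b" "typed R \<epsilon>\<^sub>b" "typed R \<mu>\<^sub>w" "typed R \<eta>\<^sub>w" "k \<in> carrier R \<Longrightarrow> typed R (scal k)"
  "typed R \<Delta>\<^sub>w" "typed R \<epsilon>\<^sub>w" "typed R \<mu>\<^sub>b" "typed R \<eta>\<^sub>b" "k \<in> carrier R \<Longrightarrow> typed R (scal_op k)"
  "typed R Swap" "typed R Id0" "typed R Id1"
  using has_type_IH_gen[where R=R] has_type.swap[of "IH R"] has_type.id0[of "IH R"] has_type.id1[of "IH R"]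
  by (simp_all add: typed_def numeral_2_eq_2)

lemma ap_seq': "\<lbrakk>typed R t; typed R u; coar t = ar u\<rbrakk> \<Longrightarrow> ap R n (t ;; u) i x = ap R n u i (ap R n t i x)"
  unfolding typed_def by (metis ap_seq)

lemma ap_par': "\<lbrakk>typed R t; typed R u\<rbrakk> \<Longrightarrow> ap R n (t \<boxplus> u) i x = ap R n t i (ap R n u (i + ar t) x)"
  unfolding typed_def by (rule ap_par)

lemma rotate_wire_gen:
  assumes "typed R t" "0 < ar t"
  shows "rotate_wire R n (coar t) i (ap R n t (Suc i) x) = ap R n t i (rotate_wire R n (ar t) i x)"
  using rotate_wire_natural'[OF typedD] assms .

lemma ap_Id0: "i < width R n x \<Longrightarrow> ap R n Id0 i x = x"
  using ap_id[where k=0] by simp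

lemma prop_eq_ih_eqns:
  assumes "ring R" "(t, u) \<in> ih_eqns R"
  shows "prop_eq (IH R) t u"
proof -
  have "(t, u) \<in> eqns (IH R)"
    using assms(2) by (simp add: IH_def quot_pres_def)
  then show ?thesis
    using has_type_ih_eqns[OF assms] prop_eq.eqn by blast
qed

lemma gens_eqns_IH:
  "g \<in> gens (HA R) \<Longrightarrow> Inl g \<in> gens (IH R) \<and> arity (IH R) (Inl g) = arity (HA R) g
     \<and> coarity (IH R) (Inl g) = coarity (HA R) g"
  "g \<in> gens (HAop R) \<Longrightarrow> Inr g \<in> gens (IH R) \<and> arity (IH R) (Inr g) = arity (HAop R) g
     \<and> coarity (IH R) (Inr g) = coarity (HAop R) g"
  "(t, u) \<in> eqns (HA R) \<Longrightarrow> (map_tm Inl t, map_tm Inl u) \<in> eqns (IH R)"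
  "(t, u) \<in> eqns (HAop R) \<Longrightarrow> (map_tm Inr t, map_tm Inr u) \<in> eqns (IH R)"
  using gens_HA_HAop[of g R] eqns_HA_HAop[of t u R] by (simp_all add: IH_def quot_pres_def)

lemma has_type_IH_Inl: "has_type (HA R) t a b \<Longrightarrow> has_type (IH R) (map_tm Inl t) a b"
  using has_type_map_tm[where P="HA R" and Q="IH R" and f=Inl] gens_eqns_IH by blast

lemma has_type_IH_Inr: "has_type (HAop R) t a b \<Longrightarrow> has_type (IH R) (map_tm Inr t) a b"
  using has_type_map_tm[where P="HAop R" and Q="IH R" and f=Inr] gens_eqns_IH by blast

lemma prop_eq_ha_eqns:
  assumes "ring R" "(t, u) \<in> ha_eqns R"
  shows "prop_eq (IH R) (map_tm Inl t) (map_tm Inl u)"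
    "prop_eq (IH R) (map_tm Inr (rev_tm t)) (map_tm Inr (rev_tm u))"
proof -
  obtain a b where ab: "has_type (HA R) t a b" "has_type (HA R) u a b"
    using has_type_ha_eqns[OF assms] by blast
  have e: "(t, u) \<in> eqns (HA R)" using assms(2) by (simp add: HA_def)
  then have e': "(rev_tm t, rev_tm u) \<in> eqns (HAop R)" by (force simp: HAop_def op_pres_def)
  show "prop_eq (IH R) (map_tm Inl t) (map_tm Inl u)"
    using gens_eqns_IH(3)[OF e] ab[THEN has_type_IH_Inl] by (rule prop_eq.eqn)
  have "has_type (HAop R) (rev_tm t) b a" "has_type (HAop R) (rev_tm u) b a"
    using ab[THEN has_type_rev_tm] by (simp_all add: HAop_def)
  then show "prop_eq (IH R) (map_tm Inr (rev_tm t)) (map_tm Inr (rev_tm u))"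
    using gens_eqns_IH(4)[OF e'] has_type_IH_Inr by (intro prop_eq.eqn) blast+
qed

context
  fixes R :: "('r, 'z) ring_scheme" (structure) and n :: nat
  assumes R: "domain R"
begin

interpretation domain R by (rule R)

interpretation wires R "width R n" "ap R n" by (rule wires_ap)

lemmas ap_simps = ap_seq' ap_par' typed_seq typed_par typed_gen ap_Id1 ap_Id0
  ap_Id1_inner ap_Id1_outer ap_Id1_outwards

lemmas HA_ap = ap_prop_eq[OF prop_eq_ha_eqns(1)[OF ring_axioms]]
lemmas HAop_ap = ap_prop_eq[OF prop_eq_ha_eqns(2)[OF ring_axioms]]
lemmas IH_ap = ap_prop_eq[OF prop_eq_ih_eqns[OF ring_axioms]]

lemma width_ap_typed [simp]: "typed R t \<Longrightarrow> i + ar t < width R n x \<Longrightarrow> width R n (ap R n t i x) = width R n x - ar t + coar t"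
  by (rule width_ap[OF typedD])

text \<open>\<open>swap_scal\<close> carries no carrier condition; for scalars outside the carrier
  both of its sides are the error state.\<close>

lemma ap_untyped_scal:
  assumes "k \<notin> carrier R"
  shows "ap R n (scal k) i x = {}" "ap R n (scal_op k) i x = {}"
proof -
  have "Inl (Scal k) \<notin> gens (IH R)" "Inr (Scal k) \<notin> gens (IH R)"
    using assms by (auto simp: HA_def HAop_def op_pres_def HA_HAop_def coprod_pres_def IH_def quot_pres_def)
  then have "\<nexists>a b. has_type (IH R) (scal k) a b" "\<nexists>a b. has_type (IH R) (scal_op k) a b"
    by (auto elim: has_type_GenE)
  then show "ap R n (scal k) i x = {}" "ap R n (scal_op k) i x = {}"
    by (simp_all add: ap_untyped)
qed

lemma hopf_HA:
  "hopf R (width R n) (ap R n \<Delta>\<^sub>b) (ap R n \<epsilon>\<^sub>b) (ap R n \<mu>\<^sub>w) (ap R n \<eta>\<^sub>w) (\<lambda>k. ap R n (scal k)) (ap R n Swap)"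
  apply (rule hopf.intro)
  subgoal using HA_ap[OF ha_eqns.mult_unit] by (simp add: ap_simps)
  subgoal using HA_ap[OF ha_eqns.mult_comm] by (simp add: ap_simps)
  subgoal using HA_ap[OF ha_eqns.mult_assoc] by (simp add: ap_simps)
  subgoal using HA_ap[OF ha_eqns.comult_counit] by (simp add: ap_simps)
  subgoal using HA_ap[OF ha_eqns.comult_comm] by (simp add: ap_simps)
  subgoal using HA_ap[OF ha_eqns.comult_assoc] by (simp add: ap_simps)
  subgoal using HA_ap[OF ha_eqns.mult_counit] by (simp add: ap_simps)
  subgoal using HA_ap[OF ha_eqns.mult_comult] by (simp add: ap_simps)
  subgoal using HA_ap[OF ha_eqns.unit_comult] by (simp add: ap_simps)
  subgoal using HA_ap[OF ha_eqns.unit_counit] by (simp add: ap_simps)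
  subgoal using HA_ap[OF ha_eqns.scal_one] by (simp add: ap_simps)
  subgoal using HA_ap[OF ha_eqns.scal_scal] by (simp add: ap_simps)
  subgoal using HA_ap[OF ha_eqns.mult_scal] by (simp add: ap_simps)
  subgoal using HA_ap[OF ha_eqns.unit_scal] by (simp add: ap_simps)
  subgoal using HA_ap[OF ha_eqns.scal_comult] by (simp add: ap_simps)
  subgoal using HA_ap[OF ha_eqns.scal_counit] by (simp add: ap_simps)
  subgoal using HA_ap[OF ha_eqns.scal_zero] by (simp add: ap_simps)
  subgoal using HA_ap[OF ha_eqns.scal_add] by (simp add: ap_simps)
  subgoal using rotate_wire_gen[of R "\<Delta>\<^sub>b"] by (simp add: typed_gen numeral_2_eq_2)
  subgoal using rotate_wire_gen[of R "\<epsilon>\<^sub>b"] by (simp add: typed_gen numeral_2_eq_2)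
  subgoal using rotate_wire_gen[of R "\<mu>\<^sub>w"] by (simp add: typed_gen numeral_2_eq_2)
  subgoal using rotate_wire_natural[OF typedD[OF typed_gen(4)], where R=R] by simp
  subgoal for i k using rotate_wire_gen[of R "scal k"] by (cases "k \<in> carrier R") (simp_all add: typed_gen ap_untyped_scal)
  done

text \<open>Reversal exchanges the laws of multiplication with those of comultiplication, so each
  axiom is drawn from its dual.\<close>

lemma hopf_HAop:
  "hopf R (width R n) (ap R n \<Delta>\<^sub>w) (ap R n \<epsilon>\<^sub>w) (ap R n \<mu>\<^sub>b) (ap R n \<eta>\<^sub>b) (\<lambda>k. ap R n (scal_op k)) (ap R n Swap)"
  apply (rule hopf.intro)
  subgoal using HAop_ap[OF ha_eqns.comult_counit] by (simp add: ap_simps)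
  subgoal using HAop_ap[OF ha_eqns.comult_comm] by (simp add: ap_simps)
  subgoal using HAop_ap[OF ha_eqns.comult_assoc] by (simp add: ap_simps)
  subgoal using HAop_ap[OF ha_eqns.mult_unit] by (simp add: ap_simps)
  subgoal using HAop_ap[OF ha_eqns.mult_comm] by (simp add: ap_simps)
  subgoal using HAop_ap[OF ha_eqns.mult_assoc] by (simp add: ap_simps)
  subgoal using HAop_ap[OF ha_eqns.unit_comult] by (simp add: ap_simps)
  subgoal using HAop_ap[OF ha_eqns.mult_comult] by (simp add: ap_simps)
  subgoal using HAop_ap[OF ha_eqns.mult_counit] by (simp add: ap_simps)
  subgoal using HAop_ap[OF ha_eqns.unit_counit] by (simp add: ap_simps)
  subgoal using HAop_ap[OF ha_eqns.scal_one] by (simp add: ap_simps)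
  \<comment> \<open>Reversal also exchanges the two factors; commutativity of the ring restores
    their order.\<close>
  subgoal using HAop_ap[OF ha_eqns.scal_scal] by (simp add: ap_simps m_comm)
  subgoal using HAop_ap[OF ha_eqns.scal_comult] by (simp add: ap_simps)
  subgoal using HAop_ap[OF ha_eqns.scal_counit] by (simp add: ap_simps)
  subgoal using HAop_ap[OF ha_eqns.mult_scal] by (simp add: ap_simps)
  subgoal using HAop_ap[OF ha_eqns.unit_scal] by (simp add: ap_simps)
  subgoal using HAop_ap[OF ha_eqns.scal_zero] by (simp add: ap_simps)
  subgoal using HAop_ap[OF ha_eqns.scal_add] by (simp add: ap_simps)
  subgoal using rotate_wire_gen[of R "\<Delta>\<^sub>w"] by (simp add: typed_gen numeral_2_eq_2)
  subgoal using rotate_wire_gen[of R "\<epsilon>\<^sub>w"] by (simp add: typed_gen numeral_2_eq_2)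
  subgoal using rotate_wire_gen[of R "\<mu>\<^sub>b"] by (simp add: typed_gen numeral_2_eq_2)
  subgoal using rotate_wire_natural[OF typedD[OF typed_gen(9)], where R=R] by simp
  subgoal for i k using rotate_wire_gen[of R "scal_op k"] by (cases "k \<in> carrier R") (simp_all add: typed_gen ap_untyped_scal)
  done

lemma ih_wires_ap: "ih_wires R (width R n) (ap R n)"
  apply (intro ih_wires.intro ih_wires_axioms.intro R wires_ap hopf_HA hopf_HAop)
  subgoal using IH_ap[OF ih_eqns.scal_scal_op] by (simp add: ap_simps)
  subgoal using IH_ap[OF ih_eqns.scal_op_scal] by (simp add: ap_simps)
  subgoal using IH_ap[OF ih_eqns.frobenius_w1] by (simp add: ap_simps)
  subgoal using IH_ap[OF ih_eqns.frobenius_w2] by (simp add: ap_simps)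
  subgoal using IH_ap[OF ih_eqns.frobenius_b1] by (simp add: ap_simps)
  subgoal using IH_ap[OF ih_eqns.frobenius_b2] by (simp add: ap_simps)
  subgoal using IH_ap[OF ih_eqns.cup] by (simp add: ap_simps)
  subgoal using IH_ap[OF ih_eqns.cap] by (simp add: ap_simps)
  subgoal using IH_ap[OF ih_eqns.special_w] by (simp add: ap_simps)
  subgoal using IH_ap[OF ih_eqns.special_b] by (simp add: ap_simps)
  done

end

section \<open>From states back to arrows of the two sub-PROPs\<close>

lemma ap_map_tm:
  assumes "has_type (IH R) u n m" "has_type Q s a b" "i + a \<le> m"
    and emb: "\<And>t a b. has_type Q t a b \<Longrightarrow> has_type (IH R) (map_tm e t) a b"
  shows "ap R n (map_tm e s) i (arrow_of (IH R) u) = arrow_of (IH R) (u ;; map_tm e (pad i s (m - (i + a))))"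
    and "has_type Q (pad i s (m - (i + a))) m (m - a + b)"
proof -
  show "ap R n (map_tm e s) i (arrow_of (IH R) u) = arrow_of (IH R) (u ;; map_tm e (pad i s (m - (i + a))))"
    using ap_arrow_of(1)[OF assms(1) emb[OF assms(2)] assms(3)] by (simp add: map_tm_pad)
  show "has_type Q (pad i s (m - (i + a))) m (m - a + b)"
    using assms(3) by (intro has_type_pad[OF assms(2)]) auto
qed

text \<open>The renaming \<open>\<rho>\<close> lets one argument serve both claims: identity and
  colour exchange, with the two sub-PROPs as \<open>Q1\<close> and \<open>Q2\<close> in either
  order.\<close>

lemma factorisation:
  fixes R :: "('r, 'z) ring_scheme"
  assumes I: "ih_wires R (width R n) (\<lambda>t. ap R n (map_tm \<rho> t))"
    and \<rho>: "\<And>t a b. has_type (IH R) t a b \<Longrightarrow> has_type (IH R) (map_tm \<rho> t) a b"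
    and emb1: "\<And>t a b. has_type Q1 t a b \<Longrightarrow> has_type (IH R) (map_tm e1 t) a b"
    and emb2: "\<And>t a b. has_type Q2 t a b \<Longrightarrow> has_type (IH R) (map_tm e2 t) a b"
    and haop_op: "\<And>t. ih_wires.haop_op R t \<Longrightarrow> \<exists>s. has_type Q1 s (ar t) (coar t) \<and> map_tm \<rho> t = map_tm e1 s"
    and ha_op: "\<And>t. ih_wires.ha_op R t \<Longrightarrow> \<exists>s. has_type Q2 s (ar t) (coar t) \<and> map_tm \<rho> t = map_tm e2 s"
    and t: "has_type (IH R) t n m"
  shows "\<exists>z t1 t2. has_type Q1 t1 n z \<and> has_type Q2 t2 z m \<and>
    prop_eq (IH R) (map_tm \<rho> t) (map_tm e1 t1 ;; map_tm e2 t2)"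
proof -
  interpret ih_wires R "width R n" "\<lambda>t. ap R n (map_tm \<rho> t)" by (rule I)
  define x0 where "x0 = arrow_of (IH R) (idn n)"
  have x0: "0 < width R n x0"
    using width_arrow_of[OF has_type_idn[of "IH R" n]] by (simp add: x0_def)
  have op: "\<exists>t z. has_type Q1 t n z \<and> x = arrow_of (IH R) (map_tm e1 t)" if "op_arrow x0 x" for x
    using that
  proof (induction rule: op_arrow.induct)
    case base
    have "x0 = arrow_of (IH R) (map_tm e1 (idn n))"
      by (simp add: x0_def map_tm_idn)
    then show ?case using has_type_idn by blast
  next
    case (step x t i)
    then obtain u z where u: "has_type Q1 u n z" "x = arrow_of (IH R) (map_tm e1 u)" by blast
    obtain s where s: "has_type Q1 s (ar t) (coar t)" "map_tm \<rho> t = map_tm e1 s"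
      using haop_op step.hyps by blast
    have "i + ar t \<le> z"
      using step.hyps(3) u width_arrow_of[OF emb1[OF u(1)]] by simp
    note ap_map_tm[OF emb1[OF u(1)] s(1) this emb1]
    then show ?case
      using has_type.seq[OF u(1)] u(2) s(2) by (metis tm.map(5))
  qed
  have fac: "\<exists>t1 z t2 m. has_type Q1 t1 n z \<and> has_type Q2 t2 z m \<and> x = arrow_of (IH R) (map_tm e1 t1 ;; map_tm e2 t2)"
    if "factored x0 x" for x
    using that
  proof (induction rule: factored.induct)
    case (base x)
    then obtain t z where t: "has_type Q1 t n z" "x = arrow_of (IH R) (map_tm e1 t)" using op by blast
    then have "x = arrow_of (IH R) (map_tm e1 t ;; map_tm e2 (idn z))"
      using arrow_ofI[OF prop_eq.seq_id_right[OF emb1[OF t(1)]]] by (simp add: map_tm_idn)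
    then show ?case using t(1) has_type_idn by blast
  next
    case (step x t i)
    then obtain t1 z t2 m where u: "has_type Q1 t1 n z" "has_type Q2 t2 z m"
      "x = arrow_of (IH R) (map_tm e1 t1 ;; map_tm e2 t2)" by blast
    then have ut: "has_type (IH R) (map_tm e1 t1 ;; map_tm e2 t2) n m"
      using emb1 emb2 has_type.seq by blast
    obtain s where s: "has_type Q2 s (ar t) (coar t)" "map_tm \<rho> t = map_tm e2 s"
      using ha_op step.hyps by blast
    have le: "i + ar t \<le> m"
      using step.hyps(3) u(3) width_arrow_of[OF ut] by simp
    let ?p = "pad i s (m - (i + ar t))"
    note ap = ap_map_tm[OF ut s(1) le emb2]
    have "ap R n (map_tm \<rho> t) i x = arrow_of (IH R) (map_tm e1 t1 ;; map_tm e2 (t2 ;; ?p))"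
      using ap(1) u(3) s(2) arrow_ofI[OF prop_eq.seq_assoc[OF emb1[OF u(1)] emb2[OF u(2)] emb2[OF ap(2)]]]
      by simp
    then show ?case
      using u(1) has_type.seq[OF u(2) ap(2)] by blast
  qed
  \<comment> \<open>Closure under single generators extends to all terms by induction on typing:
    \<open>;;\<close> and \<open>\<boxplus>\<close> become successive attachments.\<close>
  have all: "factored x0 (ap R n (map_tm \<rho> t) i y)"
    if "has_type (IH R) t a b" "factored x0 y" "i + a < width R n y" for t a b i y
    using that
  proof (induction arbitrary: i y rule: has_type.induct)
    case (gen g)
    have ar: "arity (IH R) g = ar (Gen g)"
      using has_type_IH_ar[OF has_type.gen[OF gen.hyps]] by simp
    obtain h where h: "g = Inl h \<or> g = Inr h" by (cases g) auto
    have "ha_op (Gen g) \<or> haop_op (Gen g)"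
      using gen.hyps h by (cases h)
        (auto intro: ha_op.intros haop_op.intros
          simp: HA_def HAop_def op_pres_def HA_HAop_def coprod_pres_def IH_def quot_pres_def)
    then show ?case
      using factored.step[OF gen.prems(1)] factored_haop_op[OF x0 _ gen.prems(1)] gen.prems(2) ar
      by (auto simp del: tm.map)
  next
    case id0
    then show ?case by (simp add: ap_Id0)
  next
    case id1
    then show ?case by (simp add: ap_Id1)
  next
    case swap
    then show ?case using factored.step[OF swap.prems(1) ha_op.intros(6)] by simp
  next
    case (seq t a b u c)
    have "ap R n (map_tm \<rho> (t ;; u)) i y = ap R n (map_tm \<rho> u) i (ap R n (map_tm \<rho> t) i y)"
      using ap_seq[OF seq.hyps[THEN \<rho>]] by simp
    then show ?case
      using seq.IH seq.prems width_ap[OF \<rho>[OF seq.hyps(1)] seq.prems(2)] by simp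
  next
    case (par t a b u c d)
    have "ap R n (map_tm \<rho> (t \<boxplus> u)) i y = ap R n (map_tm \<rho> t) i (ap R n (map_tm \<rho> u) (i + a) y)"
      using ap_par(1)[OF par.hyps[THEN \<rho>]] by simp
    then show ?case
      using par.IH par.prems width_ap[OF \<rho>[OF par.hyps(2)], of "i + a" n y] by simp
  qed
  \<comment> \<open>The term attached to the identity on \<open>n\<close> is its own class.\<close>
  have pad: "has_type (IH R) (pad 0 (map_tm \<rho> t) 0) n m"
    by (rule has_type_pad[OF \<rho>[OF t]]) auto
  have "prop_eq (IH R) (idn n ;; pad 0 (map_tm \<rho> t) 0) (map_tm \<rho> t)"
    using prop_eq.seq_id_left[OF pad] pad_0[OF \<rho>[OF t]] by (rule prop_eq.trans)
  then have x: "ap R n (map_tm \<rho> t) 0 x0 = arrow_of (IH R) (map_tm \<rho> t)"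
    using ap_arrow_of(1)[OF has_type_idn[of "IH R" n] \<rho>[OF t], of 0] arrow_ofI by (simp add: x0_def)
  have "factored x0 (ap R n (map_tm \<rho> t) 0 x0)"
    using all[OF t factored.base[OF op_arrow.base], of 0] width_arrow_of[OF has_type_idn[of "IH R" n]]
    by (simp add: x0_def)
  from fac[OF this] x obtain t1 z t2 m' where u: "has_type Q1 t1 n z" "has_type Q2 t2 z m'"
    "arrow_of (IH R) (map_tm \<rho> t) = arrow_of (IH R) (map_tm e1 t1 ;; map_tm e2 t2)" by auto
  then have eq: "prop_eq (IH R) (map_tm \<rho> t) (map_tm e1 t1 ;; map_tm e2 t2)"
    using arrow_of_eq_iff[OF \<rho>[OF t]] by blast
  \<comment> \<open>\<open>fac\<close> leaves the codomain open; uniqueness of types makes it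
    \<open>m\<close>.\<close>
  have "has_type (IH R) (map_tm e1 t1 ;; map_tm e2 t2) n m'"
    using u(1,2) emb1 emb2 has_type.seq by blast
  moreover obtain a b where "has_type (IH R) (map_tm \<rho> t) a b" "has_type (IH R) (map_tm e1 t1 ;; map_tm e2 t2) a b"
    using prop_eq_has_type[OF eq] by blast
  ultimately have "m' = m"
    using has_type_unique \<rho>[OF t] by blast
  with u eq show ?thesis by blast
qed

lemma has_type_HA_gen:
  fixes R :: "('r, 'z) ring_scheme" (structure)
  shows
  "has_type (HA R) (Gen Comult_b) (Suc 0) (Suc (Suc 0))" "has_type (HA R) (Gen Counit_b) (Suc 0) 0"
  "has_type (HA R) (Gen Mult_w) (Suc (Suc 0)) (Suc 0)" "has_type (HA R) (Gen Unit_w) 0 (Suc 0)"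
  "k \<in> carrier R \<Longrightarrow> has_type (HA R) (Gen (Scal k)) (Suc 0) (Suc 0)"
  "has_type (HA R) Swap (Suc (Suc 0)) (Suc (Suc 0))"
  using has_type.swap[of "HA R"] by (auto intro!: has_type_gen' simp: HA_def numeral_2_eq_2)

lemma has_type_HAop_gen:
  fixes R :: "('r, 'z) ring_scheme" (structure)
  shows
  "has_type (HAop R) (Gen Comult_b) (Suc (Suc 0)) (Suc 0)" "has_type (HAop R) (Gen Counit_b) 0 (Suc 0)"
  "has_type (HAop R) (Gen Mult_w) (Suc 0) (Suc (Suc 0))" "has_type (HAop R) (Gen Unit_w) (Suc 0) 0"
  "k \<in> carrier R \<Longrightarrow> has_type (HAop R) (Gen (Scal k)) (Suc 0) (Suc 0)"
  "has_type (HAop R) Swap (Suc (Suc 0)) (Suc (Suc 0))"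
  using has_type_HA_gen[where R=R, THEN has_type_rev_tm] by (simp_all add: HAop_def)

theorem theorem6p2:
  fixes R :: "('r, 'z) ring_scheme" and n m :: nat
    and c :: "('r ha_gen + 'r ha_gen) tm set"
  assumes "principal_domain R"
    and "c \<in> arrows (IH R) n m"
  shows "(\<exists>z. \<exists>c1 \<in> arrows (HAop R) n z. \<exists>c2 \<in> arrows (HA R) z m.
            c = arrow_comp (IH R) (\<phi>2 R c1) (\<phi>1 R c2))
       \<and> (\<exists>z. \<exists>c3 \<in> arrows (HA R) n z. \<exists>c4 \<in> arrows (HAop R) z m.
            c = arrow_comp (IH R) (\<phi>1 R c3) (\<phi>2 R c4))"
proof -
  interpret principal_domain R by (rule assms(1))
  interpret ih_wires R "width R n" "ap R n"
    by (rule ih_wires_ap) (rule domain_axioms)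
  obtain t where t: "has_type (IH R) t n m" "c = arrow_of (IH R) t"
    using assms(2) by (auto simp: arrows_eq)
  have haop_op_id: "\<exists>s. has_type (HAop R) s (ar t) (coar t) \<and> map_tm id t = map_tm Inr s" if "haop_op t" for t
    \<comment> \<open>\<open>case_sum id id\<close> forgets the tag of the summand, which leaves the
      generator under its name in the sub-PROP.\<close>
    by (rule exI[of _ "map_tm (case_sum id id) (map_tm id t)"], use that in cases)
      (auto simp: has_type_HAop_gen)
  have haop_op_swap: "\<exists>s. has_type (HA R) s (ar t) (coar t) \<and> map_tm colour_swap t = map_tm Inl s" if "haop_op t" for t
    by (rule exI[of _ "map_tm (case_sum id id) (map_tm colour_swap t)"], use that in cases)
      (auto simp: has_type_HA_gen)
  have ha_op_id: "\<exists>s. has_type (HA R) s (ar t) (coar t) \<and> map_tm id t = map_tm Inl s" if "ha_op t" for t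
    by (rule exI[of _ "map_tm (case_sum id id) (map_tm id t)"], use that in cases)
      (auto simp: has_type_HA_gen)
  have ha_op_swap: "\<exists>s. has_type (HAop R) s (ar t) (coar t) \<and> map_tm colour_swap t = map_tm Inr s" if "ha_op t" for t
    by (rule exI[of _ "map_tm (case_sum id id) (map_tm colour_swap t)"], use that in cases)
      (auto simp: has_type_HAop_gen)
  have "ih_wires R (width R n) (\<lambda>t. ap R n (map_tm id t))"
    using ih_wires_axioms by (simp add: tm.map_id)
  from factorisation[OF this _ has_type_IH_Inr has_type_IH_Inl haop_op_id ha_op_id t(1)]
  obtain z t1 t2 where 1: "has_type (HAop R) t1 n z" "has_type (HA R) t2 z m"
    "prop_eq (IH R) t (map_tm Inr t1 ;; map_tm Inl t2)"
    by (auto simp: tm.map_id)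
  \<comment> \<open>The recoloured term is factorised in the recoloured model, whose opposite
    generators lie in \<open>HA\<close>; recolouring twice returns \<open>t\<close>.\<close>
  from factorisation[OF ih_wires_colour_swap has_type_map_tm_colour_swap has_type_IH_Inl has_type_IH_Inr
      haop_op_swap ha_op_swap has_type_map_tm_colour_swap[OF t(1)]]
  obtain z' t3 t4 where 2: "has_type (HA R) t3 n z'" "has_type (HAop R) t4 z' m"
    "prop_eq (IH R) t (map_tm Inl t3 ;; map_tm Inr t4)"
    by auto
  have "c = arrow_comp (IH R) (\<phi>2 R (arrow_of (HAop R) t1)) (\<phi>1 R (arrow_of (HA R) t2))"
    using 1 t(2) by (simp add: \<phi>1_arrow_of \<phi>2_arrow_of arrow_ofI
        arrow_comp_arrow_of[OF has_type_IH_Inr has_type_IH_Inl])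
  moreover have "c = arrow_comp (IH R) (\<phi>1 R (arrow_of (HA R) t3)) (\<phi>2 R (arrow_of (HAop R) t4))"
    using 2 t(2) by (simp add: \<phi>1_arrow_of \<phi>2_arrow_of arrow_ofI
        arrow_comp_arrow_of[OF has_type_IH_Inl has_type_IH_Inr])
  ultimately show ?thesis
    using 1(1,2) 2(1,2) unfolding arrows_eq by blast
qed

end
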